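(* In the Kronecker quantum cluster algebra with principal coefficients $\mathcal{A}_q(Q)$, with cluster variables $x_l$ ($l\in\mathbb{Z}$), coefficients $y_1,y_2$, and elements $S_n$ (modified Chebyshev polynomials of the second kind evaluated at $X_\delta$), the following hold: (1) $S_n x_0=x_{-n}+ q^{-\frac{1}{2}} S_{n-1} X^{(1,0,0,1)}$ for $n \geq 1$; (2) $S_n x_{-m}=x_{-(m+n)}+ X^{(0,0,1,1)} S_{n-1}x_{-(m-1)}$ for $n\geq 1$ and $m \geq 1$; (3) $x_1 S_n =x_{n+1}+ q^{-\frac{1}{2}} x_0 y_1S_{n-1}$ for $n \geq 1$; (4) $x_m S_n=x_{n+m}+ x_{m-1} X^{(0,0,1,1)}S_{n-1}$ for $n\geq 1$ and $m \geq 2$.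
   Context: Let $k=\mathbb{F}_q$ be a finite field with $q$ elements. Let $\Lambda$ be the skew-symmetric bilinear form on $\mathbb{Z}^4$ (natural basis $e_1,\dots,e_4$) with $\Lambda(e_1,e_3)=-1$, $\Lambda(e_2,e_4)=-1$, $\Lambda(e_3,e_4)=-2$, $\Lambda(e_1,e_2)=\Lambda(e_1,e_4)=\Lambda(e_2,e_3)=0$. The quantum torus is the $\mathbb{Z}[q^{\pm 1/2}]$-algebra with basis $\{X^{e}: e\in\mathbb{Z}^4\}$ and product $X^{e}X^{f}=q^{\Lambda(e,f)/2}X^{e+f}$. All identities are in this algebra. Put $y_1=X^{(0,0,1,0)}$, $y_2=X^{(0,0,0,1)}$ (the coefficients). Let $Q$ be the Kronecker quiver with two vertices $1,2$ and two arrows $1\to 2$. For $l\ge 0$ let $V(-l)$ be the indecomposable preprojective $kQ$-module with dimension vector $(l,l+1)$ and $V(l+3)$ the indecomposable preinjective $kQ$-module with dimension vector $(l+1,l)$. For a $kQ$-module $M$ with dimension vector $m=(m_1,m_2)$, the quantum cluster character is $$X_M=\sum_{e=(e_1,e_2)}|\mathrm{Gr}_e M|\,q^{-\frac12\langle e,m-e\rangle}X^{(2m_2-m_1-2e_2,\;2e_1-m_2,\;m_1-e_1,\;m_2-e_2)},$$ where $\mathrm{Gr}_eM$ is the set of submodules of $M$ of dimension vector $e$ and $\langle a,b\rangle=a_1b_1+a_2b_2-2a_1b_2$ is the Euler form. The cluster variables are $x_1=X^{(1,0,0,0)}$, $x_2=X^{(0,1,0,0)}$ and $x_l=X_{V(l)}$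 for $l\in\mathbb{Z}\setminus\{1,2\}$. The algebra $\mathcal{A}_q(Q)$ is the subalgebra of the quantum torus generated over $\mathbb{Z}[q^{\pm1/2}][y_1^{\pm1},y_2^{\pm1}]$ by all $x_l$, $l\in\mathbb{Z}$. Let $X_\delta=X^{(1,-1,1,1)}+X^{(-1,-1,1,0)}+X^{(-1,1,0,0)}$. Define $S_0=1$, $S_1=X_\delta$, $S_2=S_1S_1-X^{(0,0,1,1)}$, and $S_{n+1}=S_nS_1-X^{(0,0,1,1)}S_{n-1}$ for $n\ge 2$. *)

theory Defs
  imports Complex_Main "HOL-Library.Cardinality" "HOL-Library.Poly_Mapping"
    "HOL-Library.Product_Plus"
begin

section \<open>The coefficient ring\<close>

text \<open>Here \<open>q\<close> is the number of elements of the finite field \<open>'k\<close>, so \<open>\<int>[q\<^sup>1\<^sup>/\<^sup>2, q\<^sup>-\<^sup>1\<^sup>/\<^sup>2]\<close> is a subring of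
  the reals, with \<open>q\<^sup>1\<^sup>/\<^sup>2\<close> the positive square root.\<close>

inductive_set half_laurent :: "real \<Rightarrow> real set" for q :: real where
  one: "1 \<in> half_laurent q"
| root: "sqrt q \<in> half_laurent q"
| inv_root: "inverse (sqrt q) \<in> half_laurent q"
| diff: "a \<in> half_laurent q \<Longrightarrow> b \<in> half_laurent q \<Longrightarrow> a - b \<in> half_laurent q"
| mult: "a \<in> half_laurent q \<Longrightarrow> b \<in> half_laurent q \<Longrightarrow> a * b \<in> half_laurent q"

lemma half_laurent_zero: "0 \<in> half_laurent q"
  using half_laurent.diff[OF half_laurent.one half_laurent.one] by simp

lemma half_laurent_uminus: "a \<in> half_laurent q \<Longrightarrow> - a \<in> half_laurent q"
  using half_laurent.diff[OF half_laurent_zero] by fastforce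

lemma half_laurent_add:
  "a \<in> half_laurent q \<Longrightarrow> b \<in> half_laurent q \<Longrightarrow> a + b \<in> half_laurent q"
  using half_laurent.diff[OF _ half_laurent_uminus] by fastforce

lemma half_laurent_power: "a \<in> half_laurent q \<Longrightarrow> a ^ n \<in> half_laurent q"
  by (induction n) (auto intro: half_laurent.one half_laurent.mult)

lemma half_laurent_powi: "sqrt q powi n \<in> half_laurent q"
  by (cases n rule: int_cases4)
     (auto simp: power_int_minus power_inverse[symmetric] simp del: power_inverse
       intro: half_laurent_power half_laurent.root half_laurent.inv_root)

typedef (overloaded) ('k::finite) coeff = "half_laurent (real CARD('k))"
  using half_laurent_zero by blast

setup_lifting type_definition_coeff

instantiation coeff :: (finite) comm_ring_1
begin

lift_definition zero_coeff :: "'a coeff" is 0 by (rule half_laurent_zero)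
lift_definition one_coeff :: "'a coeff" is 1 by (rule half_laurent.one)
lift_definition plus_coeff :: "'a coeff \<Rightarrow> 'a coeff \<Rightarrow> 'a coeff" is "(+)"
  by (rule half_laurent_add)
lift_definition minus_coeff :: "'a coeff \<Rightarrow> 'a coeff \<Rightarrow> 'a coeff" is "(-)"
  by (rule half_laurent.diff)
lift_definition uminus_coeff :: "'a coeff \<Rightarrow> 'a coeff" is uminus
  by (rule half_laurent_uminus)
lift_definition times_coeff :: "'a coeff \<Rightarrow> 'a coeff \<Rightarrow> 'a coeff" is "(*)"
  by (rule half_laurent.mult)

instance
  by standard (transfer; simp add: algebra_simps)+

end

text \<open>\<open>qhalf n\<close> is \<open>q\<close> to the power \<open>n/2\<close>.\<close>

lift_definition qhalf :: "int \<Rightarrow> ('k::finite) coeff" is "\<lambda>n. sqrt (real CARD('k)) powi n"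
  by (rule half_laurent_powi)

lemma qhalf_0 [simp]: "qhalf 0 = 1"
  by transfer simp

lemma qhalf_add: "qhalf (m + n) = qhalf m * qhalf n"
  by transfer (simp add: power_int_add)

lifting_forget coeff.lifting


section \<open>The quantum torus\<close>

type_synonym expo = "int \<times> int \<times> int \<times> int"

fun Lam :: "expo \<Rightarrow> expo \<Rightarrow> int" where
  "Lam (a1, a2, a3, a4) (b1, b2, b3, b4) =
     - (a1 * b3 - a3 * b1) - (a2 * b4 - a4 * b2) - 2 * (a3 * b4 - a4 * b3)"

lemma Lam_add_left: "Lam (a + b) c = Lam a c + Lam b c"
  by (cases a; cases b; cases c) (simp add: algebra_simps)

lemma Lam_add_right: "Lam a (b + c) = Lam a b + Lam a c"
  by (cases a; cases b; cases c) (simp add: algebra_simps)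

lemma Lam_zero [simp]: "Lam 0 a = 0" "Lam a 0 = 0"
  by (cases a; simp add: zero_prod_def)+

text \<open>A copy of the finitely supported functions, because \<open>\<Rightarrow>\<^sub>0\<close> already carries the
  untwisted product.\<close>

typedef (overloaded) ('k::finite) qtorus = "UNIV :: (expo \<Rightarrow>\<^sub>0 'k coeff) set"
  by simp

setup_lifting type_definition_qtorus

definition twisted_mult ::
  "(expo \<Rightarrow>\<^sub>0 ('k::finite) coeff) \<Rightarrow> (expo \<Rightarrow>\<^sub>0 'k coeff) \<Rightarrow> (expo \<Rightarrow>\<^sub>0 'k coeff)" where
  "twisted_mult f g = (\<Sum>a\<in>Poly_Mapping.keys f. \<Sum>b\<in>Poly_Mapping.keys g.
     Poly_Mapping.single (a + b) (Poly_Mapping.lookup f a * Poly_Mapping.lookup g b * qhalf (Lam a b)))"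

lemma twisted_mult_superset:
  assumes "finite A" "Poly_Mapping.keys f \<subseteq> A" "finite B" "Poly_Mapping.keys g \<subseteq> B"
  shows "twisted_mult f g = (\<Sum>a\<in>A. \<Sum>b\<in>B.
     Poly_Mapping.single (a + b) (Poly_Mapping.lookup f a * Poly_Mapping.lookup g b * qhalf (Lam a b)))"
proof -
  have "twisted_mult f g = (\<Sum>a\<in>Poly_Mapping.keys f. \<Sum>b\<in>B.
     Poly_Mapping.single (a + b) (Poly_Mapping.lookup f a * Poly_Mapping.lookup g b * qhalf (Lam a b)))"
    unfolding twisted_mult_def
    by (intro sum.cong refl sum.mono_neutral_left assms) (auto simp: in_keys_iff)
  also have "\<dots> = (\<Sum>a\<in>A. \<Sum>b\<in>B.
     Poly_Mapping.single (a + b) (Poly_Mapping.lookup f a * Poly_Mapping.lookup g b * qhalf (Lam a b)))"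
    by (intro sum.mono_neutral_left assms ballI sum.neutral) (auto simp: in_keys_iff)
  finally show ?thesis .
qed

lemma twisted_mult_add_left: "twisted_mult (f + f') g = twisted_mult f g + twisted_mult f' g"
proof -
  let ?A = "Poly_Mapping.keys f \<union> Poly_Mapping.keys f'"
  have "Poly_Mapping.keys (f + f') \<subseteq> ?A" by (rule Poly_Mapping.keys_add)
  then show ?thesis
    by (simp add: twisted_mult_superset[where A = ?A and B = "Poly_Mapping.keys g"] lookup_add distrib_right
        single_add sum.distrib)
qed

lemma twisted_mult_add_right: "twisted_mult g (f + f') = twisted_mult g f + twisted_mult g f'"
proof -
  let ?A = "Poly_Mapping.keys f \<union> Poly_Mapping.keys f'"
  have "Poly_Mapping.keys (f + f') \<subseteq> ?A" by (rule Poly_Mapping.keys_add)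
  then show ?thesis
    by (simp add: twisted_mult_superset[where A = "Poly_Mapping.keys g" and B = ?A] lookup_add distrib_right
        distrib_left single_add sum.distrib)
qed

lemma twisted_mult_zero: "twisted_mult 0 g = 0" "twisted_mult g 0 = 0"
  by (simp_all add: twisted_mult_def)

lemma twisted_mult_single:
  "twisted_mult (Poly_Mapping.single a x) (Poly_Mapping.single b y) =
     Poly_Mapping.single (a + b) (x * y * qhalf (Lam a b))"
  by (simp add: twisted_mult_superset[where A = "{a}" and B = "{b}"])

lemma poly_mapping_additive_induct:
  fixes f :: "'a \<Rightarrow>\<^sub>0 'b::comm_monoid_add"
  assumes "P 0" "\<And>a x. P (Poly_Mapping.single a x)" "\<And>f g. P f \<Longrightarrow> P g \<Longrightarrow> P (f + g)"
  shows "P f"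
proof -
  have "P (\<Sum>a\<in>A. Poly_Mapping.single a (Poly_Mapping.lookup f a))" for A
    by (induction A rule: infinite_finite_induct) (simp_all add: assms)
  moreover have "(\<Sum>a\<in>Poly_Mapping.keys f. Poly_Mapping.single a (Poly_Mapping.lookup f a)) = f"
    by (rule poly_mapping_eqI)
       (auto simp: lookup_sum lookup_single when_def in_keys_iff sum.delta' cong: if_cong)
  ultimately show ?thesis
    by metis
qed

lemma twisted_mult_assoc:
  "twisted_mult (twisted_mult f g) h = twisted_mult f (twisted_mult g h)"
proof (induction f rule: poly_mapping_additive_induct)
  case (2 a x)
  show ?case
  proof (induction g rule: poly_mapping_additive_induct)
    case (2 b y)
    show ?case
      by (induction h rule: poly_mapping_additive_induct)
         (simp_all add: twisted_mult_zero twisted_mult_add_right twisted_mult_single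
           Lam_add_left Lam_add_right qhalf_add ac_simps)
  qed (simp_all add: twisted_mult_zero twisted_mult_add_left twisted_mult_add_right)
qed (simp_all add: twisted_mult_zero twisted_mult_add_left)

lemma twisted_mult_one_left: "twisted_mult (Poly_Mapping.single 0 1) f = f"
  by (induction f rule: poly_mapping_additive_induct)
     (simp_all add: twisted_mult_zero twisted_mult_add_right twisted_mult_single del: single_one)

lemma twisted_mult_one_right: "twisted_mult f (Poly_Mapping.single 0 1) = f"
  by (induction f rule: poly_mapping_additive_induct)
     (simp_all add: twisted_mult_zero twisted_mult_add_left twisted_mult_single del: single_one)

instantiation qtorus :: (finite) ring_1
begin

lift_definition zero_qtorus :: "'a qtorus" is 0 .
lift_definition one_qtorus :: "'a qtorus" is "Poly_Mapping.single 0 1" .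
lift_definition plus_qtorus :: "'a qtorus \<Rightarrow> 'a qtorus \<Rightarrow> 'a qtorus" is "(+)" .
lift_definition minus_qtorus :: "'a qtorus \<Rightarrow> 'a qtorus \<Rightarrow> 'a qtorus" is "(-)" .
lift_definition uminus_qtorus :: "'a qtorus \<Rightarrow> 'a qtorus" is uminus .
lift_definition times_qtorus :: "'a qtorus \<Rightarrow> 'a qtorus \<Rightarrow> 'a qtorus" is twisted_mult .

instance
proof
  fix a b c :: "'a qtorus"
  show "a * b * c = a * (b * c)" by transfer (rule twisted_mult_assoc)
  show "1 * a = a" by transfer (rule twisted_mult_one_left)
  show "a * 1 = a" by transfer (rule twisted_mult_one_right)
  show "(a + b) * c = a * c + b * c" by transfer (rule twisted_mult_add_left)
  show "a * (b + c) = a * b + a * c" by transfer (rule twisted_mult_add_right)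
  show "a + b + c = a + (b + c)" by transfer (rule add.assoc)
  show "a + b = b + a" by transfer (rule add.commute)
  show "0 + a = a" by transfer (rule add_0)
  show "- a + a = 0" by transfer (rule left_minus)
  show "a - b = a + - b" by transfer (rule diff_conv_add_uminus)
  show "(0::'a qtorus) \<noteq> 1"
    by transfer (metis lookup_single_eq lookup_zero zero_neq_one)
qed

end

lift_definition X :: "expo \<Rightarrow> ('k::finite) qtorus" is "\<lambda>e. Poly_Mapping.single e 1" .

definition coeff_scale :: "('k::finite) coeff \<Rightarrow> (expo \<Rightarrow>\<^sub>0 'k coeff) \<Rightarrow> (expo \<Rightarrow>\<^sub>0 'k coeff)" where
  "coeff_scale c = Poly_Mapping.map ((*) c)"

lift_definition scl :: "('k::finite) coeff \<Rightarrow> 'k qtorus \<Rightarrow> 'k qtorus"  (infixr "\<cdot>" 75)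
  is coeff_scale .

lemma lookup_coeff_scale: "Poly_Mapping.lookup (coeff_scale c f) a = c * Poly_Mapping.lookup f a"
  by (simp add: coeff_scale_def map.rep_eq when_def)

lemma coeff_scale_add: "coeff_scale c (f + g) = coeff_scale c f + coeff_scale c g"
  by (rule poly_mapping_eqI) (simp add: lookup_coeff_scale lookup_add distrib_left)

lemma coeff_scale_zero: "coeff_scale c 0 = 0"
  by (rule poly_mapping_eqI) (simp add: lookup_coeff_scale)

lemma coeff_scale_single:
  "coeff_scale c (Poly_Mapping.single a x) = Poly_Mapping.single a (c * x)"
  by (rule poly_mapping_eqI) (simp add: lookup_coeff_scale lookup_single when_def)

lemma X_mult: "X e * X f = qhalf (Lam e f) \<cdot> X (e + f)"
  by transfer (simp add: twisted_mult_single coeff_scale_single)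

lemma X_zero: "X 0 = 1"
  by transfer simp

lemma scl_mult_left: "(c \<cdot> x) * y = c \<cdot> (x * y)"
proof (transfer, goal_cases)
  case (1 c x y)
  show ?case
  proof (induction x rule: poly_mapping_additive_induct)
    case (2 a u)
    show ?case
      by (induction y rule: poly_mapping_additive_induct)
         (simp_all add: twisted_mult_zero twisted_mult_add_right twisted_mult_single
           coeff_scale_add coeff_scale_zero coeff_scale_single ac_simps)
  qed (simp_all add: twisted_mult_zero twisted_mult_add_left coeff_scale_add coeff_scale_zero)
qed

lemma scl_mult_right: "x * (c \<cdot> y) = c \<cdot> (x * y)"
proof (transfer, goal_cases)
  case (1 x c y)
  show ?case
  proof (induction x rule: poly_mapping_additive_induct)
    case (2 a u)
    show ?case
      by (induction y rule: poly_mapping_additive_induct)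
         (simp_all add: twisted_mult_zero twisted_mult_add_right twisted_mult_single
           coeff_scale_add coeff_scale_zero coeff_scale_single ac_simps)
  qed (simp_all add: twisted_mult_zero twisted_mult_add_left coeff_scale_add coeff_scale_zero)
qed

definition y1 :: "('k::finite) qtorus" where "y1 = X (0, 0, 1, 0)"


section \<open>Modules over the Kronecker quiver\<close>

text \<open>A finite-dimensional module is given as a representation: two finite-dimensional subspaces
  of an ambient vector space \<open>'v\<close> over the field \<open>'k\<close> with scalar multiplication \<open>scale\<close>, one for
  each vertex, and two linear maps from the first to the second.  The maps are total functions
  on \<open>'v\<close>; their values outside the first subspace are irrelevant.\<close>

record 'v kronecker =
  sp1 :: "'v set"
  sp2 :: "'v set"
  arrA :: "'v \<Rightarrow> 'v"
  arrB :: "'v \<Rightarrow> 'v"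

definition fin_dim_subspace ::
  "('k::field \<Rightarrow> 'v::ab_group_add \<Rightarrow> 'v) \<Rightarrow> 'v set \<Rightarrow> bool" where
  "fin_dim_subspace scale U \<longleftrightarrow> (\<exists>B. finite B \<and> U = module.span scale B)"

definition linear_between ::
  "('k::field \<Rightarrow> 'v::ab_group_add \<Rightarrow> 'v) \<Rightarrow> 'v set \<Rightarrow> 'v set \<Rightarrow> ('v \<Rightarrow> 'v) \<Rightarrow> bool" where
  "linear_between scale U W f \<longleftrightarrow>
     (\<forall>u\<in>U. f u \<in> W) \<and> (\<forall>u\<in>U. \<forall>v\<in>U. f (u + v) = f u + f v) \<and>
     (\<forall>c. \<forall>u\<in>U. f (scale c u) = scale c (f u))"

definition kronecker_module ::
  "('k::field \<Rightarrow> 'v::ab_group_add \<Rightarrow> 'v) \<Rightarrow> 'v kronecker \<Rightarrow> bool" where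
  "kronecker_module scale M \<longleftrightarrow>
     fin_dim_subspace scale (sp1 M) \<and> fin_dim_subspace scale (sp2 M) \<and>
     linear_between scale (sp1 M) (sp2 M) (arrA M) \<and>
     linear_between scale (sp1 M) (sp2 M) (arrB M)"

definition dim_vector ::
  "('k::field \<Rightarrow> 'v::ab_group_add \<Rightarrow> 'v) \<Rightarrow> 'v kronecker \<Rightarrow> nat \<times> nat" where
  "dim_vector scale M = (vector_space.dim scale (sp1 M), vector_space.dim scale (sp2 M))"

definition submodules ::
  "('k::field \<Rightarrow> 'v::ab_group_add \<Rightarrow> 'v) \<Rightarrow> 'v kronecker \<Rightarrow> ('v set \<times> 'v set) set" where
  "submodules scale M = {(U, W).
     module.subspace scale U \<and> module.subspace scale W \<and> U \<subseteq> sp1 M \<and> W \<subseteq> sp2 M \<and>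
     arrA M ` U \<subseteq> W \<and> arrB M ` U \<subseteq> W}"

definition direct_sum :: "'v::ab_group_add set \<Rightarrow> 'v set \<Rightarrow> 'v set \<Rightarrow> bool" where
  "direct_sum V U U' \<longleftrightarrow> V = {u + u' | u u'. u \<in> U \<and> u' \<in> U'} \<and> U \<inter> U' = {0}"

definition indecomposable ::
  "('k::field \<Rightarrow> 'v::ab_group_add \<Rightarrow> 'v) \<Rightarrow> 'v kronecker \<Rightarrow> bool" where
  "indecomposable scale M \<longleftrightarrow>
     kronecker_module scale M \<and> (sp1 M, sp2 M) \<noteq> ({0}, {0}) \<and>
     (\<forall>U W U' W'. (U, W) \<in> submodules scale M \<longrightarrow> (U', W') \<in> submodules scale M \<longrightarrow>
        direct_sum (sp1 M) U U' \<longrightarrow> direct_sum (sp2 M) W W' \<longrightarrow>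
        (U, W) = ({0}, {0}) \<or> (U', W') = ({0}, {0}))"

text \<open>An indecomposable module of dimension vector \<open>(l, l + 1)\<close> is automatically preprojective, and
  one of dimension vector \<open>(l + 1, l)\<close> is automatically preinjective, so the following says that
  \<open>V l\<close> is (a representative of the isomorphism class of) the indecomposable preprojective module
  of dimension vector \<open>(-l, -l + 1)\<close> for \<open>l \<le> 0\<close>, and the indecomposable preinjective module of
  dimension vector \<open>(l - 2, l - 3)\<close> for \<open>l \<ge> 3\<close>.  The values at \<open>1\<close> and \<open>2\<close> are irrelevant.\<close>

definition kronecker_family ::
  "('k::field \<Rightarrow> 'v::ab_group_add \<Rightarrow> 'v) \<Rightarrow> (int \<Rightarrow> 'v kronecker) \<Rightarrow> bool" where
  "kronecker_family scale V \<longleftrightarrow>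
     (\<forall>l::nat. indecomposable scale (V (- int l)) \<and> dim_vector scale (V (- int l)) = (l, l + 1)) \<and>
     (\<forall>l::nat. indecomposable scale (V (int l + 3)) \<and> dim_vector scale (V (int l + 3)) = (l + 1, l))"


section \<open>Quantum cluster characters, cluster variables, Chebyshev elements\<close>

definition Gr ::
  "('k::field \<Rightarrow> 'v::ab_group_add \<Rightarrow> 'v) \<Rightarrow> nat \<times> nat \<Rightarrow> 'v kronecker \<Rightarrow> ('v set \<times> 'v set) set" where
  "Gr scale e M = {(U, W) \<in> submodules scale M.
     vector_space.dim scale U = fst e \<and> vector_space.dim scale W = snd e}"

fun euler_form :: "int \<times> int \<Rightarrow> int \<times> int \<Rightarrow> int" where
  "euler_form (a1, a2) (b1, b2) = a1 * b1 + a2 * b2 - 2 * a1 * b2"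

text \<open>\<open>Gr scale e M\<close> is empty unless \<open>e \<le> m\<close> componentwise, so the sum is over that range.\<close>

definition cluster_char ::
  "('k::{field,finite} \<Rightarrow> 'v::ab_group_add \<Rightarrow> 'v) \<Rightarrow> 'v kronecker \<Rightarrow> 'k qtorus" where
  "cluster_char scale M = (case dim_vector scale M of (m1, m2) \<Rightarrow>
     (\<Sum>(e1, e2) \<in> {0..m1} \<times> {0..m2}.
        (of_nat (card (Gr scale (e1, e2) M)) *
         qhalf (- euler_form (int e1, int e2) (int m1 - int e1, int m2 - int e2))) \<cdot>
        X (2 * int m2 - int m1 - 2 * int e2, 2 * int e1 - int m2,
           int m1 - int e1, int m2 - int e2)))"

definition cluster_var ::
  "('k::{field,finite} \<Rightarrow> 'v::ab_group_add \<Rightarrow> 'v) \<Rightarrow> (int \<Rightarrow> 'v kronecker) \<Rightarrow> int \<Rightarrow> 'k qtorus" where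
  "cluster_var scale V l =
     (if l = 1 then X (1, 0, 0, 0) else if l = 2 then X (0, 1, 0, 0) else cluster_char scale (V l))"

definition X_delta :: "('k::finite) qtorus" where
  "X_delta = X (1, -1, 1, 1) + X (-1, -1, 1, 0) + X (-1, 1, 0, 0)"

fun S :: "nat \<Rightarrow> ('k::finite) qtorus" where
  "S 0 = 1"
| "S (Suc 0) = X_delta"
| "S (Suc (Suc n)) = S (Suc n) * S (Suc 0) - X (0, 0, 1, 1) * S n"

end

theory Submission
  imports Defs "HOL-Library.Function_Algebras"
begin

text \<open>Write \<open>Z = X (0, 0, 1, 1)\<close>.  All four identities are instances of one Chebyshev argument.
  The elements \<open>S\<^sub>n\<close> obey a three-term recurrence with coefficient \<open>Z\<close>, and \<open>Z\<close> commutes with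
  \<open>X_delta\<close>.  Hence a sequence with \<open>X_delta p\<^sub>k\<^sub>+\<^sub>1 = p\<^sub>k\<^sub>+\<^sub>2 + Z p\<^sub>k\<close> satisfies
  \<open>S\<^sub>n p\<^sub>k\<^sub>+\<^sub>1 = p\<^sub>k\<^sub>+\<^sub>1\<^sub>+\<^sub>n + Z S\<^sub>n\<^sub>-\<^sub>1 p\<^sub>k\<close> (\<open>chebyshev_left\<close>, and \<open>chebyshev_right\<close> for the opposite
  order of the factors).  The cluster variables \<open>x\<^sub>0, x\<^sub>-\<^sub>1, \<dots>\<close> form such a sequence, and
  \<open>x\<^sub>1, x\<^sub>2, \<dots>\<close> form one for the opposite order.  Each needs one further term in front of its
  first member, and this term accounts for the exceptional last summands in the identities for \<open>x\<^sub>0\<close> and \<open>x\<^sub>1\<close>.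

  So only \<open>n = 1\<close> is left.  Comparing coefficients of monomials, the relation between three
  consecutive cluster variables becomes a recurrence for the number of submodules of given dimension
  of the preprojective modules (\<open>count_subs_rec\<close>, used in \<open>preprojective_recurrence\<close> and
  \<open>preinjective_recurrence\<close>).  It is proved in the model whose spaces are the polynomials of degree
  less than \<open>l\<close> and at most \<open>l\<close>, with inclusion and multiplication by \<open>t\<close> as the arrows.  A submodule
  is cut with the polynomials of degree one less; it is recovered from this smaller submodule
  \<open>(U, W)\<close> and a monic polynomial of top degree.  If the monic polynomial is to be adjoined to \<open>U\<close>, it
  has to lie in \<open>W\<close>, which excludes exactly those \<open>(U, W)\<close> that come from the module smaller by two
  steps; this is the origin of the term with \<open>Z\<close>.

  To apply the count to an arbitrary indecomposable module of dimension vector \<open>(l, l + 1)\<close>, such a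
  module must be identified with the model (\<open>indecomposable_preprojective\<close>).  Passing to the kernel
  of \<open>(a, b) \<mapsto> A a - B b\<close>, a reflection functor, lowers \<open>l\<close> by one and preserves
  indecomposability, and the module can be rebuilt from this kernel.  Preinjective modules are treated
  by duality: taking annihilators matches the submodules of a module with those of its dual
  (\<open>card_Gr_dual\<close>).  Over a finite field the required linear algebra is a matter of counting.\<close>

section \<open>Finite vector spaces by counting\<close>

lemma card_kernel_image:
  fixes f :: "'a::ab_group_add \<Rightarrow> 'b::ab_group_add"
  assumes "finite U" and z: "0 \<in> U" and add: "\<And>x y. x \<in> U \<Longrightarrow> y \<in> U \<Longrightarrow> x + y \<in> U"
    and diff: "\<And>x y. x \<in> U \<Longrightarrow> y \<in> U \<Longrightarrow> x - y \<in> U"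
    and f: "\<And>x y. x \<in> U \<Longrightarrow> y \<in> U \<Longrightarrow> f (x + y) = f x + f y"
  shows "card U = card {u \<in> U. f u = 0} * card (f ` U)"
proof -
  have fd: "f (x - y) = f x - f y" if "x \<in> U" "y \<in> U" for x y
    using f[OF diff[OF that] that(2)] by (simp add: algebra_simps)
  have fibre: "card {u \<in> U. f u = y} = card {u \<in> U. f u = 0}" if "y \<in> f ` U" for y
  proof -
    obtain v where v: "v \<in> U" "y = f v" using \<open>y \<in> f ` U\<close> by blast
    have "bij_betw (\<lambda>u. u - v) {u \<in> U. f u = y} {u \<in> U. f u = 0}"
      by (rule bij_betw_byWitness[where f' = "\<lambda>u. u + v"]) (use v in \<open>auto simp: fd f add diff\<close>)
    then show ?thesis by (rule bij_betw_same_card)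
  qed
  have "card U = (\<Sum>y\<in>f ` U. card {u \<in> U. f u = y})"
    using sum.image_gen[OF \<open>finite U\<close>, of "\<lambda>_. 1::nat" f] by (simp only: card_eq_sum)
  also have "\<dots> = (\<Sum>y\<in>f ` U. card {u \<in> U. f u = 0})"
    by (rule sum.cong) (use fibre in auto)
  finally show ?thesis by simp
qed

text \<open>Over a finite field with \<open>q\<close> elements a finite subspace of dimension \<open>d\<close> has \<open>q\<^sup>d\<close> elements, so
  rank and nullity, complements and annihilators can all be handled by counting vectors.  This
  suits modules whose spaces are subspaces of an ambient space of unknown dimension.\<close>

locale finite_field_space = vector_space scale
  for scale :: "'k::{field,finite} \<Rightarrow> 'v::ab_group_add \<Rightarrow> 'v"
begin

lemma card_field_gt_1: "1 < CARD('k)"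
proof -
  have "card {0::'k, 1} \<le> CARD('k)" by (rule card_mono) auto
  then show ?thesis by simp
qed

lemma finite_span: "finite B \<Longrightarrow> finite (span B)"
proof (induction B rule: finite_induct)
  case (insert b B)
  have "span (insert b B) \<subseteq> (\<lambda>(c, v). scale c b + v) ` (UNIV \<times> span B)"
  proof
    fix x assume "x \<in> span (insert b B)"
    then obtain c where "x - scale c b \<in> span B" by (auto simp: span_insert)
    then show "x \<in> (\<lambda>(c, v). scale c b + v) ` (UNIV \<times> span B)"
      by (intro image_eqI[where x = "(c, x - scale c b)"]) auto
  qed
  then show ?case
    by (rule finite_subset) (use insert in auto)
qed simp

lemma fin_dim_subspace_iff: "fin_dim_subspace scale U \<longleftrightarrow> subspace U \<and> finite U"
  unfolding fin_dim_subspace_def by (metis finite_span span_eq_iff subspace_span)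

lemma card_span_independent:
  assumes "finite B" "independent B"
  shows "card (span B) = CARD('k) ^ card B"
  using assms
proof (induction B rule: finite_induct)
  case (insert b B)
  have b: "b \<notin> span B" and B: "independent B"
    using insert.prems insert.hyps by (auto simp: independent_insert)
  let ?f = "\<lambda>(c, v). scale c b + v"
  have "bij_betw ?f (UNIV \<times> span B) (span (insert b B))"
  proof (rule bij_betw_imageI)
    show "inj_on ?f (UNIV \<times> span B)"
    proof (rule inj_onI, clarsimp)
      fix c c' v v' assume v: "v \<in> span B" "v' \<in> span B" and eq: "scale c b + v = scale c' b + v'"
      have "scale (c - c') b = v' - v"
        using eq by (simp add: scale_left_diff_distrib algebra_simps)
      then have mem: "scale (c - c') b \<in> span B" using v by (simp add: span_diff)
      have "c = c'"
      proof (rule ccontr)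
        assume "c \<noteq> c'"
        with span_scale[OF mem, of "inverse (c - c')"] have "b \<in> span B" by simp
        then show False using b by simp
      qed
      then show "c = c' \<and> v = v'" using eq by simp
    qed
    show "?f ` (UNIV \<times> span B) = span (insert b B)"
    proof (intro equalityI subsetI)
      fix x assume "x \<in> span (insert b B)"
      then obtain c where "x - scale c b \<in> span B" by (auto simp: span_insert)
      then show "x \<in> ?f ` (UNIV \<times> span B)"
        by (intro image_eqI[where x = "(c, x - scale c b)"]) auto
    next
      fix x assume "x \<in> ?f ` (UNIV \<times> span B)"
      then obtain c v where "v \<in> span B" "x = scale c b + v" by auto
      then show "x \<in> span (insert b B)" by (auto simp: span_insert intro!: exI[of _ c])
    qed
  qed
  then have "card (span (insert b B)) = card ((UNIV :: 'k set) \<times> span B)"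
    by (rule bij_betw_same_card[symmetric])
  then show ?case using insert.IH[OF B] insert.hyps by (simp add: card_cartesian_product)
qed simp

lemma card_subspace:
  assumes "subspace U" "finite U"
  shows "card U = CARD('k) ^ dim U"
proof -
  obtain B where B: "B \<subseteq> U" "independent B" "U \<subseteq> span B" "card B = dim U"
    using basis_exists by blast
  have "span B = U" using B(1,3) assms(1) by (rule span_subspace)
  moreover have "finite B" using B(1) assms(2) by (rule finite_subset)
  ultimately show ?thesis using card_span_independent[OF _ B(2)] B(4) by simp
qed

lemma dim_eq_iff_card:
  assumes "subspace U" "finite U"
  shows "dim U = n \<longleftrightarrow> card U = CARD('k) ^ n"
  using card_subspace[OF assms] card_field_gt_1 by simp

lemma card_subspace_pos: "subspace U \<Longrightarrow> finite U \<Longrightarrow> 0 < card U"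
  using card_gt_0_iff subspace_0 by blast

lemma card_functional_kernel:
  assumes U: "subspace U" "finite U"
    and add: "\<And>x y. x \<in> U \<Longrightarrow> y \<in> U \<Longrightarrow> f (x + y) = f x + f y"
    and mult: "\<And>c x. x \<in> U \<Longrightarrow> f (scale c x) = (c::'k) * f x"
    and nz: "\<exists>u\<in>U. f u \<noteq> 0"
  shows "card U = card {u \<in> U. f u = 0} * CARD('k)"
proof -
  obtain u where u: "u \<in> U" "f u \<noteq> 0" using nz by blast
  have "c \<in> f ` U" for c
    by (rule image_eqI[where x = "scale (c / f u) u"]) (use u U in \<open>auto simp: mult subspace_scale\<close>)
  then have "f ` U = UNIV" by blast
  moreover have "card U = card {u \<in> U. f u = 0} * card (f ` U)"
    by (rule card_kernel_image) (use U add in \<open>auto intro: subspace_0 subspace_add subspace_diff\<close>)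
  ultimately show ?thesis by simp
qed

text \<open>A subspace of \<open>U\<close> of maximal size among those meeting \<open>N\<close> trivially is a complement: any vector
  outside \<open>N + C\<close> could be adjoined to \<open>C\<close>.\<close>

lemma complement_exists:
  assumes "subspace N" "subspace U" "finite U" "N \<subseteq> U"
  obtains C where "subspace C" "C \<subseteq> U" "direct_sum U N C"
proof -
  let ?P = "\<lambda>C. subspace C \<and> C \<subseteq> U \<and> N \<inter> C = {0}"
  have bd: "card C \<le> card U" if "?P C" for C
    using that assms(3) by (auto intro: card_mono)
  have "?P {0}" using assms by (auto simp: subspace_0)
  then have "\<exists>C. ?P C \<and> (\<forall>D. ?P D \<longrightarrow> card D \<le> card C)"
    by (rule ex_has_greatest_nat[where b = "Suc (card U)"]) (use bd in \<open>simp add: less_Suc_eq_le\<close>)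
  then obtain C where C: "?P C" and max: "\<And>D. ?P D \<Longrightarrow> card D \<le> card C" by blast
  have "x \<in> {n + c | n c. n \<in> N \<and> c \<in> C}" if "x \<in> U" for x
  proof (rule ccontr)
    assume x: "x \<notin> {n + c | n c. n \<in> N \<and> c \<in> C}"
    let ?D = "span (insert x C)"
    have CD: "C \<subseteq> ?D" "x \<in> ?D" by (auto intro: span_base)
    have DU: "?D \<subseteq> U" using that C assms(2) by (intro span_minimal) auto
    have "N \<inter> ?D \<subseteq> {0}"
    proof
      fix y assume "y \<in> N \<inter> ?D"
      then have yN: "y \<in> N" and "y \<in> ?D" by auto
      then obtain c where c: "y - scale c x \<in> C"
        using C by (metis span_breakdown_eq span_eq_iff)
      have "c = 0"
      proof (rule ccontr)
        assume "c \<noteq> 0"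
        then have "x = scale (inverse c) y + scale (- inverse c) (y - scale c x)"
          by (simp add: scale_right_diff_distrib)
        moreover have "scale (inverse c) y \<in> N" using yN assms(1) by (simp add: subspace_scale)
        moreover have "scale (- inverse c) (y - scale c x) \<in> C"
          using c C subspace_scale by blast
        ultimately show False using x by blast
      qed
      then show "y \<in> {0}" using c yN C by auto
    qed
    then have "?P ?D" using DU assms(1) by (auto simp: subspace_0 span_zero)
    then have "card ?D \<le> card C" by (rule max)
    moreover have "finite ?D" using DU assms(3) by (rule finite_subset)
    ultimately have "C = ?D" using CD(1) by (meson card_seteq)
    then have "x \<in> C" using CD(2) by simp
    then have "x = 0 + x \<and> 0 \<in> N \<and> x \<in> C" using assms(1) by (simp add: subspace_0)
    then show False using x by blast
  qed
  moreover have "n + c \<in> U" if "n \<in> N" "c \<in> C" for n c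
    using that C assms by (auto intro: subspace_add)
  ultimately have "direct_sum U N C" unfolding direct_sum_def using C by blast
  then show thesis using C that by blast
qed

lemma card_direct_sum:
  assumes "subspace A" "subspace B" "A \<inter> B = {0}"
  shows "card {a + b | a b. a \<in> A \<and> b \<in> B} = card A * card B"
proof -
  let ?f = "\<lambda>(a, b). a + b"
  have "inj_on ?f (A \<times> B)"
  proof (rule inj_onI, clarsimp)
    fix a b a' b' assume m: "a \<in> A" "a' \<in> A" "b \<in> B" "b' \<in> B" and eq: "a + b = a' + b'"
    then have "a - a' = b' - b" by (simp add: algebra_simps)
    moreover have "a - a' \<in> A" "b' - b \<in> B" using m assms by (auto intro: subspace_diff)
    ultimately have "a - a' \<in> A \<inter> B" by simp
    then show "a = a' \<and> b = b'" using assms(3) eq by simp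
  qed
  then have "card (?f ` (A \<times> B)) = card (A \<times> B)" by (rule card_image)
  moreover have "?f ` (A \<times> B) = {a + b | a b. a \<in> A \<and> b \<in> B}" by auto
  ultimately show ?thesis by (simp add: card_cartesian_product)
qed

end


section \<open>Perfect pairings and dual modules\<close>

locale perfect_pairing =
  s: finite_field_space s + t: finite_field_space t
  for s :: "'k::{field,finite} \<Rightarrow> 'v::ab_group_add \<Rightarrow> 'v"
    and t :: "'k \<Rightarrow> 'w::ab_group_add \<Rightarrow> 'w" +
  fixes U :: "'v set" and U' :: "'w set" and p :: "'v \<Rightarrow> 'w \<Rightarrow> 'k"
  assumes sub: "s.subspace U" "t.subspace U'"
    and fin: "finite U" "finite U'"
    and add_left: "\<And>u v f. u \<in> U \<Longrightarrow> v \<in> U \<Longrightarrow> f \<in> U' \<Longrightarrow> p (u + v) f = p u f + p v f"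
    and add_right: "\<And>u f g. u \<in> U \<Longrightarrow> f \<in> U' \<Longrightarrow> g \<in> U' \<Longrightarrow> p u (f + g) = p u f + p u g"
    and scale_left: "\<And>c u f. u \<in> U \<Longrightarrow> f \<in> U' \<Longrightarrow> p (s c u) f = c * p u f"
    and scale_right: "\<And>c u f. u \<in> U \<Longrightarrow> f \<in> U' \<Longrightarrow> p u (t c f) = c * p u f"
    and nondeg_left: "\<And>u. u \<in> U \<Longrightarrow> (\<And>f. f \<in> U' \<Longrightarrow> p u f = 0) \<Longrightarrow> u = 0"
    and nondeg_right: "\<And>f. f \<in> U' \<Longrightarrow> (\<And>u. u \<in> U \<Longrightarrow> p u f = 0) \<Longrightarrow> f = 0"
begin

definition ann :: "'v set \<Rightarrow> 'w set" where
  "ann A = {f \<in> U'. \<forall>u\<in>A. p u f = 0}"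

lemma flip: "perfect_pairing t s U' U (\<lambda>f u. p u f)"
  by (unfold_locales) (use sub fin add_left add_right scale_left scale_right nondeg_left nondeg_right in auto)

lemma zero_left: "f \<in> U' \<Longrightarrow> p 0 f = 0"
  using scale_left[of 0 f 0] sub by (simp add: s.subspace_0)

lemma zero_right: "u \<in> U \<Longrightarrow> p u 0 = 0"
  using scale_right[of u 0 0] sub by (simp add: t.subspace_0)

lemma ann_subset: "ann A \<subseteq> U'"
  by (auto simp: ann_def)

lemma subspace_ann: "A \<subseteq> U \<Longrightarrow> t.subspace (ann A)"
  using sub by (auto simp: t.subspace_def ann_def add_right scale_right zero_right subset_iff)

lemma finite_ann: "finite (ann A)"
  using finite_subset[OF ann_subset fin(2)] .

text \<open>Count the pairs \<open>(u, f) \<in> A \<times> U'\<close> with \<open>p u f = 0\<close> in two ways.  A nonzero functional on a space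
  with \<open>N\<close> elements vanishes on exactly \<open>N / q\<close> of them.  For fixed \<open>u\<close> the functional \<open>p u\<close> is zero
  only if \<open>u = 0\<close>, and for fixed \<open>f\<close> the functional \<open>p _ f\<close> is zero on \<open>A\<close> only if \<open>f\<close> annihilates
  \<open>A\<close>; equating the two counts leaves \<open>(q - 1) |U'| = (q - 1) |A| |ann A|\<close>.\<close>

lemma card_ann:
  assumes A: "s.subspace A" "A \<subseteq> U"
  shows "card A * card (ann A) = card U'"
proof -
  let ?q = "CARD('k)"
  let ?P = "{(u, f). u \<in> A \<and> f \<in> U' \<and> p u f = 0}"
  have finA: "finite A" using A(2) fin(1) by (rule finite_subset)
  have cA: "0 < card A" "0 < card U'"
    using A finA sub fin by (auto intro: s.card_subspace_pos t.card_subspace_pos)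
  have "?P = Sigma A (\<lambda>u. {f \<in> U'. p u f = 0})" by auto
  then have "?q * card ?P = (\<Sum>u\<in>A. ?q * card {f \<in> U'. p u f = 0})"
    using finA fin by (simp add: card_SigmaI sum_distrib_left)
  also have "\<dots> = (\<Sum>u\<in>A. if u = 0 then ?q * card U' else card U')"
  proof (rule sum.cong[OF refl])
    fix u assume u: "u \<in> A"
    show "?q * card {f \<in> U'. p u f = 0} = (if u = 0 then ?q * card U' else card U')"
    proof (cases "u = 0")
      case True
      then have "{f \<in> U'. p u f = 0} = U'" by (auto simp: zero_left)
      then show ?thesis using True by simp
    next
      case False
      have "u \<in> U" using u A by auto
      then have "card U' = card {f \<in> U'. p u f = 0} * ?q"
        using False nondeg_left[of u] sub fin
        by (intro t.card_functional_kernel) (auto simp: add_right scale_right)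
      then show ?thesis using False by simp
    qed
  qed
  also have "\<dots> = ?q * card U' + (card A - 1) * card U'"
  proof -
    have "0 \<in> A" using A by (simp add: s.subspace_0)
    then have "(\<Sum>u\<in>A. if u = 0 then ?q * card U' else card U') =
      ?q * card U' + (\<Sum>u\<in>A - {0}. if u = 0 then ?q * card U' else card U')"
      using sum.remove[OF finA, of 0 "\<lambda>u. if u = 0 then ?q * card U' else card U'"] by simp
    also have "(\<Sum>u\<in>A - {0}. if u = 0 then ?q * card U' else card U') = (\<Sum>u\<in>A - {0}. card U')"
      by (rule sum.cong) auto
    finally show ?thesis using \<open>0 \<in> A\<close> by (simp add: card_Diff_singleton)
  qed
  finally have 1: "?q * card ?P = ?q * card U' + (card A - 1) * card U'" .
  have "bij_betw prod.swap ?P (Sigma U' (\<lambda>f. {u \<in> A. p u f = 0}))"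
    by (rule bij_betw_byWitness[where f' = prod.swap]) auto
  then have "card ?P = card (Sigma U' (\<lambda>f. {u \<in> A. p u f = 0}))" by (rule bij_betw_same_card)
  then have "?q * card ?P = (\<Sum>f\<in>U'. ?q * card {u \<in> A. p u f = 0})"
    using finA fin by (simp add: card_SigmaI sum_distrib_left)
  also have "\<dots> = (\<Sum>f\<in>U'. if f \<in> ann A then ?q * card A else card A)"
  proof (rule sum.cong[OF refl])
    fix f assume f: "f \<in> U'"
    show "?q * card {u \<in> A. p u f = 0} = (if f \<in> ann A then ?q * card A else card A)"
    proof (cases "f \<in> ann A")
      case True
      then have "{u \<in> A. p u f = 0} = A" by (auto simp: ann_def)
      then show ?thesis using True by simp
    next
      case False
      then have "\<exists>u\<in>A. p u f \<noteq> 0" using f by (auto simp: ann_def)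
      then have "card A = card {u \<in> A. p u f = 0} * ?q"
        using A finA f by (intro s.card_functional_kernel) (auto simp: add_left scale_left subset_iff)
      then show ?thesis using False by simp
    qed
  qed
  also have "\<dots> = card (ann A) * (?q * card A) + (card U' - card (ann A)) * card A"
  proof -
    have "U' \<inter> {f. f \<in> ann A} = ann A" "U' \<inter> - {f. f \<in> ann A} = U' - ann A"
      using ann_subset by auto
    then show ?thesis
      using fin(2) ann_subset[of A] finite_ann by (simp add: sum.If_cases card_Diff_subset)
  qed
  finally have 2: "?q * card ?P = card (ann A) * (?q * card A) + (card U' - card (ann A)) * card A" .
  have le: "card (ann A) \<le> card U'" using ann_subset fin(2) by (intro card_mono)
  have q: "1 < ?q" by (rule s.card_field_gt_1)
  have "int ?q * int (card U') + (int (card A) - 1) * int (card U') =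
    int (card (ann A)) * (int ?q * int (card A)) + (int (card U') - int (card (ann A))) * int (card A)"
  proof -
    have "int (card A - 1) = int (card A) - 1"
      "int (card U' - card (ann A)) = int (card U') - int (card (ann A))"
      using cA le by auto
    moreover have "int (?q * card U' + (card A - 1) * card U') =
      int (card (ann A) * (?q * card A) + (card U' - card (ann A)) * card A)"
      using 1 2 by simp
    ultimately show ?thesis by (simp only: of_nat_add of_nat_mult)
  qed
  then have "(int ?q - 1) * int (card U') = (int ?q - 1) * (int (card A) * int (card (ann A)))"
    by (simp add: algebra_simps)
  then have "int (card U') = int (card A) * int (card (ann A))" using q by simp
  then show ?thesis by (metis of_nat_eq_iff of_nat_mult)
qed

lemma ann_whole: "ann U = {0}"
  using sub by (auto simp: ann_def zero_right t.subspace_0 intro: nondeg_right)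

lemma card_eq: "card U' = card U"
  using card_ann[of U] sub by (simp add: ann_whole)

lemma ann_ann:
  assumes "s.subspace A" "A \<subseteq> U"
  shows "perfect_pairing.ann U (\<lambda>f u. p u f) (ann A) = A"
proof -
  interpret f: perfect_pairing t s U' U "\<lambda>f u. p u f" by (rule flip)
  have "card (ann A) * card (f.ann (ann A)) = card (ann A) * card A"
    using f.card_ann[OF subspace_ann ann_subset] card_ann assms card_eq by (simp add: mult.commute)
  moreover have "0 < card (ann A)"
    using assms by (intro t.card_subspace_pos subspace_ann finite_ann)
  ultimately have "card (f.ann (ann A)) = card A" by simp
  moreover have "A \<subseteq> f.ann (ann A)" using assms(2) by (auto simp: f.ann_def ann_def)
  ultimately show ?thesis using card_subset_eq[OF f.finite_ann] by metis
qed

lemma dim_ann: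
  assumes A: "s.subspace A" "A \<subseteq> U"
  shows "s.dim A + t.dim (ann A) = s.dim U"
proof -
  have "finite A" using A(2) fin(1) by (rule finite_subset)
  then have "CARD('k) ^ (s.dim A + t.dim (ann A)) = CARD('k) ^ s.dim U"
    using card_ann[OF A] card_eq s.card_subspace[OF sub(1) fin(1)] s.card_subspace[OF A(1)]
      t.card_subspace[OF subspace_ann[OF A(2)] finite_ann] by (simp add: power_add)
  then show ?thesis using s.card_field_gt_1 by simp
qed

lemma dim_eq: "t.dim U' = s.dim U"
proof -
  have "ann {0} = U'" by (auto simp: ann_def zero_left)
  then show ?thesis
    using dim_ann[of "{0}"] sub(1) s.dim_eq_iff_card[of "{0}" 0] by (simp add: s.subspace_0)
qed

text \<open>The annihilators of \<open>P\<close> and \<open>Q\<close> meet in the annihilator of \<open>P + Q\<close>, which is \<open>0\<close>; by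
  \<open>card_ann\<close> their sum is then large enough to be everything.\<close>

lemma direct_sum_ann:
  assumes P: "s.subspace P" "s.subspace Q" "P \<subseteq> U" "Q \<subseteq> U" and d: "direct_sum U P Q"
  shows "direct_sum U' (ann P) (ann Q)"
proof -
  have U: "U = {u + u' | u u'. u \<in> P \<and> u' \<in> Q}" and PQ: "P \<inter> Q = {0}"
    using d by (auto simp: direct_sum_def)
  have "ann P \<inter> ann Q \<subseteq> ann U"
  proof
    fix f assume f: "f \<in> ann P \<inter> ann Q"
    have "p u f = 0" if u: "u \<in> U" for u
    proof -
      obtain a b where "a \<in> P" "b \<in> Q" "u = a + b" using u unfolding U by blast
      then show ?thesis using f P by (auto simp: ann_def add_left subset_iff)
    qed
    then show "f \<in> ann U" using f by (auto simp: ann_def)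
  qed
  then have int: "ann P \<inter> ann Q = {0}"
    using P by (auto simp: ann_whole intro: t.subspace_0 subspace_ann)
  let ?T = "{f + g | f g. f \<in> ann P \<and> g \<in> ann Q}"
  have cT: "card ?T = card (ann P) * card (ann Q)"
    by (rule t.card_direct_sum) (use P int in \<open>auto intro: subspace_ann\<close>)
  have cU: "card U = card P * card Q"
    using s.card_direct_sum[OF P(1,2) PQ] U by simp
  have "card U * card ?T = (card P * card (ann P)) * (card Q * card (ann Q))"
    by (simp add: cT cU)
  also have "\<dots> = card U * card U'" using P by (simp add: card_ann card_eq)
  finally have "card ?T = card U'"
    using s.card_subspace_pos[OF sub(1) fin(1)] by simp
  moreover have "?T \<subseteq> U'" using sub ann_subset by (auto intro: t.subspace_add)
  ultimately have "?T = U'" by (intro card_subset_eq fin)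
  then show ?thesis using int by (simp add: direct_sum_def)
qed

lemma ann_eq_0_iff:
  assumes "s.subspace A" "A \<subseteq> U"
  shows "ann A = {0} \<longleftrightarrow> A = U"
proof
  assume "ann A = {0}"
  then have "card A = card U" using card_ann[OF assms] by (simp add: card_eq)
  then show "A = U" using card_subset_eq[OF fin(1) assms(2)] by simp
qed (simp add: ann_whole)

end

text \<open>\<open>N\<close> is a dual of \<open>M\<close>: the vertices are exchanged, and each arrow of \<open>N\<close> is the transpose of the
  corresponding arrow of \<open>M\<close> for the two pairings.  Stating this as a relation makes it symmetric,
  so that every fact about passing from \<open>M\<close> to \<open>N\<close> can also be used backwards.\<close>

locale dual_modules =
  m1: perfect_pairing s t "sp1 M" "sp2 N" p1 + m2: perfect_pairing s t "sp2 M" "sp1 N" p2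
  for s :: "'k::{field,finite} \<Rightarrow> 'v::ab_group_add \<Rightarrow> 'v"
    and t :: "'k \<Rightarrow> 'w::ab_group_add \<Rightarrow> 'w"
    and M :: "'v kronecker" and N :: "'w kronecker"
    and p1 p2 :: "'v \<Rightarrow> 'w \<Rightarrow> 'k" +
  assumes mod: "kronecker_module s M" "kronecker_module t N"
    and adjA: "\<And>u g. u \<in> sp1 M \<Longrightarrow> g \<in> sp1 N \<Longrightarrow> p2 (arrA M u) g = p1 u (arrA N g)"
    and adjB: "\<And>u g. u \<in> sp1 M \<Longrightarrow> g \<in> sp1 N \<Longrightarrow> p2 (arrB M u) g = p1 u (arrB N g)"
begin

lemma flip: "dual_modules t s N M (\<lambda>g u. p2 u g) (\<lambda>f u. p1 u f)"
  using m1.flip m2.flip mod adjA adjB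
  by (auto simp: dual_modules_def dual_modules_axioms_def)

lemma submodule_ann:
  assumes "(P, Q) \<in> submodules s M"
  shows "(m2.ann Q, m1.ann P) \<in> submodules t N"
proof -
  have PQ: "P \<subseteq> sp1 M" "Q \<subseteq> sp2 M" "arrA M ` P \<subseteq> Q" "arrB M ` P \<subseteq> Q"
    using assms by (auto simp: submodules_def)
  have AB: "arrA N g \<in> sp2 N" "arrB N g \<in> sp2 N" if "g \<in> sp1 N" for g
    using mod(2) that by (auto simp: kronecker_module_def linear_between_def)
  have "arrA N g \<in> m1.ann P" "arrB N g \<in> m1.ann P" if g: "g \<in> m2.ann Q" for g
  proof -
    have gN: "g \<in> sp1 N" and g0: "\<And>w. w \<in> Q \<Longrightarrow> p2 w g = 0" using g by (auto simp: m2.ann_def)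
    have "p1 u (arrA N g) = 0" "p1 u (arrB N g) = 0" if u: "u \<in> P" for u
    proof -
      have "u \<in> sp1 M" using u PQ by auto
      moreover have "arrA M u \<in> Q" "arrB M u \<in> Q" using u PQ by auto
      ultimately show "p1 u (arrA N g) = 0" "p1 u (arrB N g) = 0"
        using adjA[OF _ gN, of u] adjB[OF _ gN, of u] g0 by auto
    qed
    then show "arrA N g \<in> m1.ann P" "arrB N g \<in> m1.ann P"
      using AB[OF gN] by (auto simp: m1.ann_def)
  qed
  then show ?thesis
    using m1.subspace_ann[OF PQ(1)] m2.subspace_ann[OF PQ(2)] m1.ann_subset m2.ann_subset
    by (auto simp: submodules_def)
qed

lemma dim_vector_dual: "dim_vector t N = prod.swap (dim_vector s M)"
  by (simp add: dim_vector_def m1.dim_eq m2.dim_eq)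

lemma Gr_ann:
  assumes "(P, Q) \<in> Gr s (e1, e2) M" "dim_vector s M = (d1, d2)"
  shows "(m2.ann Q, m1.ann P) \<in> Gr t (d2 - e2, d1 - e1) N"
proof -
  have sub: "(P, Q) \<in> submodules s M" and dims: "m1.s.dim P = e1" "m1.s.dim Q = e2"
    using assms(1) by (auto simp: Gr_def)
  have "m1.s.subspace P" "m1.s.subspace Q" "P \<subseteq> sp1 M" "Q \<subseteq> sp2 M"
    using sub by (auto simp: submodules_def)
  then have "m1.t.dim (m1.ann P) = d1 - e1" "m1.t.dim (m2.ann Q) = d2 - e2"
    using m1.dim_ann[of P] m2.dim_ann[of Q] dims assms(2) by (auto simp: dim_vector_def)
  then show ?thesis using submodule_ann[OF sub] by (simp add: Gr_def)
qed

text \<open>Taking annihilators is an inclusion-reversing bijection between the submodules of \<open>M\<close> and those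
  of \<open>N\<close>, because annihilating twice gives back the original subspace.\<close>

lemma card_Gr_dual:
  assumes dv: "dim_vector s M = (d1, d2)" and "e1 \<le> d1" "e2 \<le> d2"
  shows "card (Gr t (d2 - e2, d1 - e1) N) = card (Gr s (e1, e2) M)"
proof -
  interpret f: dual_modules t s N M "\<lambda>g u. p2 u g" "\<lambda>f u. p1 u f" by (rule flip)
  let ?F = "\<lambda>(P, Q). (m2.ann Q, m1.ann P)" and ?G = "\<lambda>(P, Q). (f.m2.ann Q, f.m1.ann P)"
  have dN: "dim_vector t N = (d2, d1)" using dim_vector_dual dv by simp
  have "bij_betw ?F (Gr s (e1, e2) M) (Gr t (d2 - e2, d1 - e1) N)"
  proof (rule bij_betw_byWitness[where f' = ?G])
    show "\<forall>a\<in>Gr s (e1, e2) M. ?G (?F a) = a"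
      using m1.ann_ann m2.ann_ann by (auto simp: Gr_def submodules_def)
    show "\<forall>a\<in>Gr t (d2 - e2, d1 - e1) N. ?F (?G a) = a"
      using f.m1.ann_ann f.m2.ann_ann by (auto simp: Gr_def submodules_def)
    show "?F ` Gr s (e1, e2) M \<subseteq> Gr t (d2 - e2, d1 - e1) N"
      using Gr_ann[OF _ dv] by auto
    show "?G ` Gr t (d2 - e2, d1 - e1) N \<subseteq> Gr s (e1, e2) M"
      using f.Gr_ann[OF _ dN] assms(2,3) by fastforce
  qed
  then show ?thesis by (rule bij_betw_same_card[symmetric])
qed

text \<open>The annihilators of a decomposition of \<open>N\<close> decompose \<open>M\<close>.\<close>

lemma indecomposable_dual:
  assumes "indecomposable s M"
  shows "indecomposable t N"
proof -
  interpret f: dual_modules t s N M "\<lambda>g u. p2 u g" "\<lambda>f u. p1 u f" by (rule flip)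
  have nz: "(sp1 M, sp2 M) \<noteq> ({0}, {0})"
    and ind: "\<And>U W U' W'. (U, W) \<in> submodules s M \<Longrightarrow> (U', W') \<in> submodules s M \<Longrightarrow>
        direct_sum (sp1 M) U U' \<Longrightarrow> direct_sum (sp2 M) W W' \<Longrightarrow>
        (U, W) = ({0}, {0}) \<or> (U', W') = ({0}, {0})"
    using assms unfolding indecomposable_def by blast+
  have "(sp1 N, sp2 N) \<noteq> ({0}, {0})"
  proof
    assume N: "(sp1 N, sp2 N) = ({0}, {0})"
    have "u = 0" if "u \<in> sp1 M" for u
      using m1.nondeg_left[OF that] N that by (auto simp: m1.zero_right)
    moreover have "u = 0" if "u \<in> sp2 M" for u
      using m2.nondeg_left[OF that] N that by (auto simp: m2.zero_right)
    ultimately have "sp1 M = {0}" "sp2 M = {0}"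
      using m1.sub(1) m2.sub(1) m1.s.subspace_0 by blast+
    then show False using nz by simp
  qed
  moreover have "(U, W) = ({0}, {0}) \<or> (U', W') = ({0}, {0})"
    if UW: "(U, W) \<in> submodules t N" and UW': "(U', W') \<in> submodules t N"
      and d1: "direct_sum (sp1 N) U U'" and d2: "direct_sum (sp2 N) W W'" for U W U' W'
  proof -
    have sb: "m1.t.subspace U" "m1.t.subspace W" "U \<subseteq> sp1 N" "W \<subseteq> sp2 N"
      "m1.t.subspace U'" "m1.t.subspace W'" "U' \<subseteq> sp1 N" "W' \<subseteq> sp2 N"
      using UW UW' by (auto simp: submodules_def)
    have "(f.m2.ann W, f.m1.ann U) = ({0}, {0}) \<or> (f.m2.ann W', f.m1.ann U') = ({0}, {0})"
      using sb UW UW' d1 d2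
      by (intro ind f.submodule_ann f.m1.direct_sum_ann f.m2.direct_sum_ann)
    then have "(W = sp2 N \<and> U = sp1 N) \<or> (W' = sp2 N \<and> U' = sp1 N)"
      using sb by (simp add: f.m1.ann_eq_0_iff f.m2.ann_eq_0_iff)
    then show ?thesis
    proof (elim disjE conjE)
      assume "W = sp2 N" "U = sp1 N"
      then have "U \<inter> U' = U'" "W \<inter> W' = W'" using sb by auto
      then show ?thesis using d1 d2 by (simp add: direct_sum_def)
    next
      assume "W' = sp2 N" "U' = sp1 N"
      then have "U \<inter> U' = U" "W \<inter> W' = W" using sb by auto
      then show ?thesis using d1 d2 by (simp add: direct_sum_def)
    qed
  qed
  ultimately show ?thesis using mod(2) unfolding indecomposable_def by blast
qed

end


section \<open>Modules of sequences\<close>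

definition fscale :: "'k::field \<Rightarrow> (nat \<Rightarrow> 'k) \<Rightarrow> nat \<Rightarrow> 'k" where
  "fscale c f = (\<lambda>i. c * f i)"

lemma fscale_apply [simp]: "fscale c f i = c * f i"
  by (simp add: fscale_def)

global_interpretation F: finite_field_space "fscale :: 'k::{field,finite} \<Rightarrow> (nat \<Rightarrow> 'k) \<Rightarrow> nat \<Rightarrow> 'k"
  by unfold_locales (auto simp: fscale_def algebra_simps fun_eq_iff)

definition seqs :: "nat \<Rightarrow> (nat \<Rightarrow> 'k::zero) set" where
  "seqs n = {f. \<forall>i\<ge>n. f i = 0}"

lemma seqs_mono: "m \<le> n \<Longrightarrow> seqs m \<subseteq> seqs n"
  by (auto simp: seqs_def)

lemma seqs_0 [simp]: "seqs 0 = {0}"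
  by (auto simp: seqs_def fun_eq_iff)

lemma subspace_seqs: "F.subspace (seqs n)"
  by (rule F.subspaceI) (auto simp: seqs_def)

lemma seqs_Suc_image: "seqs (Suc n) \<subseteq> (\<lambda>(c, f). f(n := c)) ` (UNIV \<times> seqs n)"
proof
  fix f :: "nat \<Rightarrow> 'a" assume "f \<in> seqs (Suc n)"
  then show "f \<in> (\<lambda>(c, f). f(n := c)) ` (UNIV \<times> seqs n)"
    by (intro image_eqI[where x = "(f n, f(n := 0))"]) (auto simp: seqs_def)
qed

lemma finite_seqs: "finite (seqs n :: (nat \<Rightarrow> 'k::{zero,finite}) set)"
  by (induction n) (auto intro: finite_subset[OF seqs_Suc_image])

lemma seqs_kernel: "{f \<in> seqs (Suc n). f n = 0} = seqs n"
  unfolding seqs_def Suc_le_eq by (auto simp: le_less)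

text \<open>The coordinate \<open>f n\<close> is a nonzero functional on \<open>seqs (Suc n)\<close> with kernel \<open>seqs n\<close>.\<close>

lemma card_seqs: "card (seqs n :: (nat \<Rightarrow> 'k::{field,finite}) set) = CARD('k) ^ n"
proof (induction n)
  case (Suc n)
  have "card (seqs (Suc n) :: (nat \<Rightarrow> 'k) set) = card {f \<in> seqs (Suc n) :: (nat \<Rightarrow> 'k) set. f n = 0} * CARD('k)"
    by (rule F.card_functional_kernel)
       (auto simp: subspace_seqs finite_seqs, auto simp: seqs_def intro!: exI[of _ "\<lambda>i. if i = n then 1 else 0"])
  then show ?case by (simp add: Suc seqs_kernel)
qed simp

context finite_field_space
begin

lemma coordinates_exist:
  assumes "subspace U" "finite U"
  obtains b :: "nat \<Rightarrow> 'v" and c :: "'v \<Rightarrow> nat \<Rightarrow> 'k" where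
    "\<And>i. i < dim U \<Longrightarrow> b i \<in> U"
    "\<And>i j. i < dim U \<Longrightarrow> j < dim U \<Longrightarrow> c (b j) i = (if i = j then 1 else 0)"
    "\<And>u. u \<in> U \<Longrightarrow> (\<Sum>i<dim U. scale (c u i) (b i)) = u"
    "\<And>u v i. u \<in> U \<Longrightarrow> v \<in> U \<Longrightarrow> c (u + v) i = c u i + c v i"
    "\<And>a u i. u \<in> U \<Longrightarrow> c (scale a u) i = a * c u i"
proof -
  obtain B where B: "B \<subseteq> U" "independent B" "U \<subseteq> span B" "card B = dim U"
    using basis_exists by blast
  have sp: "span B = U" using B(1,3) assms(1) by (rule span_subspace)
  have "finite B" using B(1) assms(2) by (rule finite_subset)
  then obtain b where b: "bij_betw b {..<dim U} B"
    using B(4) ex_bij_betw_nat_finite by (metis atLeast0LessThan)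
  have bB: "b i \<in> B" if "i < dim U" for i using b that by (auto simp: bij_betw_def)
  show thesis
  proof (rule that[of b "\<lambda>u i. representation B u (b i)"])
    fix i assume "i < dim U" then show "b i \<in> U" using bB B by auto
  next
    fix i j assume ij: "i < dim U" "j < dim U"
    then have "b j = b i \<longleftrightarrow> i = j" using b by (auto simp: bij_betw_def inj_on_def)
    then show "representation B (b j) (b i) = (if i = j then 1 else 0)"
      using bB ij by (auto simp: representation_basis[OF B(2)])
  next
    fix u assume u: "u \<in> U"
    have "(\<Sum>i<dim U. scale (representation B u (b i)) (b i)) = (\<Sum>x\<in>B. scale (representation B u x) x)"
      by (rule sum.reindex_bij_betw[OF b])
    also have "\<dots> = u"
      using u by (intro sum_representation_eq B(2) \<open>finite B\<close>) (auto simp: sp)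
    finally show "(\<Sum>i<dim U. scale (representation B u (b i)) (b i)) = u" .
  qed (auto simp: representation_add representation_scale B(2) sp)
qed

lemma functional_sum:
  fixes n :: nat
  assumes "subspace U" and b: "\<And>i. i < n \<Longrightarrow> b i \<in> U"
    and add: "\<And>u v. u \<in> U \<Longrightarrow> v \<in> U \<Longrightarrow> \<phi> (u + v) = \<phi> u + \<phi> v"
    and mult: "\<And>c u. u \<in> U \<Longrightarrow> \<phi> (scale c u) = (c::'k) * \<phi> u"
  shows "\<phi> (\<Sum>i<n. scale (a i) (b i)) = (\<Sum>i<n. a i * \<phi> (b i))"
  using b
proof (induction n)
  case 0
  have "0 \<in> U" using assms(1) by (rule subspace_0)
  then show ?case using mult[of 0 0] by simp
next
  case (Suc n)
  have "(\<Sum>i<n. scale (a i) (b i)) \<in> U" "scale (a n) (b n) \<in> U"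
    using Suc.prems assms(1) by (auto intro!: subspace_sum subspace_scale)
  then show ?case using Suc by (simp add: add mult)
qed

lemma dual_space_exists:
  assumes "subspace U" "finite U"
  obtains b p where "\<And>i. i < dim U \<Longrightarrow> b i \<in> U"
    and "perfect_pairing scale fscale U (seqs (dim U)) p"
    and "\<forall>\<phi>. (\<forall>u\<in>U. \<forall>v\<in>U. \<phi> (u + v) = \<phi> u + \<phi> v) \<and> (\<forall>c. \<forall>u\<in>U. \<phi> (scale c u) = c * \<phi> u) \<longrightarrow>
      (\<forall>u\<in>U. p u (\<lambda>i. if i < dim U then \<phi> (b i) else 0) = \<phi> u)"
proof -
  let ?n = "dim U"
  obtain b c where b: "\<And>i. i < ?n \<Longrightarrow> b i \<in> U"
    and cb: "\<And>i j. i < ?n \<Longrightarrow> j < ?n \<Longrightarrow> c (b j) i = (if i = j then 1 else 0)"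
    and u: "\<And>u. u \<in> U \<Longrightarrow> (\<Sum>i<?n. scale (c u i) (b i)) = u"
    and add: "\<And>u v i. u \<in> U \<Longrightarrow> v \<in> U \<Longrightarrow> c (u + v) i = c u i + c v i"
    and mult: "\<And>a u i. u \<in> U \<Longrightarrow> c (scale a u) i = a * c u i"
    by (rule coordinates_exist[OF assms]) (rule that)
  define p where "p u f = (\<Sum>i<?n. c u i * f i)" for u f
  have "perfect_pairing scale fscale U (seqs ?n) p"
  proof unfold_locales
    fix x assume x: "x \<in> U" and z: "\<And>f. f \<in> seqs ?n \<Longrightarrow> p x f = 0"
    have "c x j = 0" if j: "j < ?n" for j
    proof -
      have "(\<lambda>i. if i = j then 1 else 0) \<in> seqs ?n" using j by (auto simp: seqs_def)
      from z[OF this] show ?thesis using j by (simp add: p_def if_distrib cong: if_cong)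
    qed
    then show "x = 0" using u[OF x] by simp
  next
    fix f assume f: "f \<in> seqs ?n" and z: "\<And>x. x \<in> U \<Longrightarrow> p x f = 0"
    have "f j = 0" for j
    proof (cases "j < ?n")
      case True
      have "p (b j) f = (\<Sum>i<?n. (if i = j then f i else 0))"
        unfolding p_def by (rule sum.cong) (use True in \<open>auto simp: cb\<close>)
      then show ?thesis using z[OF b[OF True]] True by simp
    qed (use f in \<open>auto simp: seqs_def\<close>)
    then show "f = 0" by (simp add: fun_eq_iff)
  qed (auto simp: assms subspace_seqs finite_seqs p_def add mult algebra_simps sum.distrib sum_distrib_left)
  moreover have "p x (\<lambda>i. if i < ?n then \<phi> (b i) else 0) = \<phi> x"
    if x: "x \<in> U" and \<phi>: "\<And>u v. u \<in> U \<Longrightarrow> v \<in> U \<Longrightarrow> \<phi> (u + v) = \<phi> u + \<phi> v"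
      "\<And>c u. u \<in> U \<Longrightarrow> \<phi> (scale c u) = c * \<phi> u" for \<phi> x
  proof -
    have "p x (\<lambda>i. if i < ?n then \<phi> (b i) else 0) = (\<Sum>i<?n. c x i * \<phi> (b i))"
      unfolding p_def by (rule sum.cong) auto
    also have "\<dots> = \<phi> x"
      using functional_sum[OF assms(1), of ?n b \<phi> "c x"] b \<phi> u[OF x] by simp
    finally show ?thesis .
  qed
  ultimately show thesis using b by (intro that[of b p]) auto
qed

text \<open>Coordinates for the two spaces of \<open>M\<close> realise the dual module inside \<open>nat \<Rightarrow> 'k\<close>, whatever space
  \<open>M\<close> lives in.  Dualising twice therefore transports any module into \<open>nat \<Rightarrow> 'k\<close>.\<close>

lemma dual_module_exists:
  assumes M: "kronecker_module scale M"
  obtains N p1 p2 where "dual_modules scale fscale M N p1 p2"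
proof -
  have sub: "subspace (sp1 M)" "finite (sp1 M)" "subspace (sp2 M)" "finite (sp2 M)"
    and lin: "linear_between scale (sp1 M) (sp2 M) (arrA M)"
      "linear_between scale (sp1 M) (sp2 M) (arrB M)"
    using M by (auto simp: kronecker_module_def fin_dim_subspace_iff)
  let ?n1 = "dim (sp1 M)" and ?n2 = "dim (sp2 M)"
  obtain b1 p1 where b1: "\<And>i. i < ?n1 \<Longrightarrow> b1 i \<in> sp1 M"
    and p1: "perfect_pairing scale fscale (sp1 M) (seqs ?n1) p1"
    and ev: "\<forall>\<phi>. (\<forall>u\<in>sp1 M. \<forall>v\<in>sp1 M. \<phi> (u + v) = \<phi> u + \<phi> v) \<and>
      (\<forall>c. \<forall>u\<in>sp1 M. \<phi> (scale c u) = c * \<phi> u) \<longrightarrow>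
      (\<forall>u\<in>sp1 M. p1 u (\<lambda>i. if i < ?n1 then \<phi> (b1 i) else 0) = \<phi> u)"
    by (rule dual_space_exists[OF sub(1,2)]) (rule that)
  obtain b2 p2 where p2: "perfect_pairing scale fscale (sp2 M) (seqs ?n2) p2"
    by (rule dual_space_exists[OF sub(3,4)]) (rule that)
  interpret p1: perfect_pairing scale fscale "sp1 M" "seqs ?n1" p1 by (rule p1)
  interpret p2: perfect_pairing scale fscale "sp2 M" "seqs ?n2" p2 by (rule p2)
  define tr :: "('v \<Rightarrow> 'v) \<Rightarrow> (nat \<Rightarrow> 'k) \<Rightarrow> nat \<Rightarrow> 'k" where
    "tr f g = (\<lambda>i. if i < ?n1 then p2 (f (b1 i)) g else 0)" for f g
  define N where "N = \<lparr>sp1 = seqs ?n2, sp2 = seqs ?n1, arrA = tr (arrA M), arrB = tr (arrB M)\<rparr>"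
  have trseqs: "tr f g \<in> seqs ?n1" for f g
    by (auto simp: tr_def seqs_def)
  have tr_lin: "linear_between fscale (seqs ?n2) (seqs ?n1) (tr f)"
    if "linear_between scale (sp1 M) (sp2 M) f" for f
  proof -
    have f: "f (b1 i) \<in> sp2 M" if "i < ?n1" for i
      using \<open>linear_between scale (sp1 M) (sp2 M) f\<close> b1[OF that] by (auto simp: linear_between_def)
    then show ?thesis
      unfolding linear_between_def
      by (auto simp: trseqs) (auto simp: tr_def fun_eq_iff p2.add_right p2.scale_right)
  qed
  have adj: "p2 (f u) g = p1 u (tr f g)"
    if f: "linear_between scale (sp1 M) (sp2 M) f" and ug: "u \<in> sp1 M" "g \<in> seqs ?n2" for f u g
    using ev[rule_format, where \<phi> = "\<lambda>u. p2 (f u) g" and u = u] f ug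
    by (auto simp: tr_def linear_between_def p2.add_left p2.scale_left)
  have "kronecker_module fscale N"
    using lin by (auto simp: N_def kronecker_module_def F.fin_dim_subspace_iff subspace_seqs finite_seqs tr_lin)
  then have "dual_modules scale fscale M N p1 p2"
    using p1 p2 M lin by (simp add: dual_modules_def dual_modules_axioms_def N_def adj)
  then show thesis by (rule that)
qed

end


section \<open>Indecomposable modules of dimension vector \<open>(l, l + 1)\<close>\<close>

definition shift :: "(nat \<Rightarrow> 'k::zero) \<Rightarrow> nat \<Rightarrow> 'k" where
  "shift f = (\<lambda>i. case i of 0 \<Rightarrow> 0 | Suc j \<Rightarrow> f j)"

lemma shift_simps [simp]: "shift f 0 = 0" "shift f (Suc i) = f i"
  by (simp_all add: shift_def)

lemma shift_add: "shift (f + g) = shift f + (shift g :: nat \<Rightarrow> 'k::field)"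
  by (auto simp: fun_eq_iff shift_def split: nat.splits)

lemma shift_fscale: "shift (fscale c f) = fscale c (shift f)"
  by (auto simp: fun_eq_iff shift_def split: nat.splits)

lemma shift_in_seqs_iff: "shift f \<in> seqs (Suc n) \<longleftrightarrow> f \<in> seqs n"
  by (auto simp: seqs_def shift_def Suc_le_eq split: nat.splits)

text \<open>Reading a sequence as the list of coefficients of a polynomial in \<open>t\<close>, this is the module of
  polynomials of degree less than \<open>l\<close>, resp. at most \<open>l\<close>, with the inclusion and multiplication by \<open>t\<close>.\<close>

definition preprojective :: "nat \<Rightarrow> (nat \<Rightarrow> 'k::field) kronecker" where
  "preprojective l = \<lparr>sp1 = seqs l, sp2 = seqs (Suc l), arrA = (\<lambda>f. f), arrB = shift\<rparr>"

definition kronecker_iso ::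
  "(nat \<Rightarrow> 'k::{field,finite}) kronecker \<Rightarrow> (nat \<Rightarrow> 'k) kronecker \<Rightarrow>
   ((nat \<Rightarrow> 'k) \<Rightarrow> nat \<Rightarrow> 'k) \<Rightarrow> ((nat \<Rightarrow> 'k) \<Rightarrow> nat \<Rightarrow> 'k) \<Rightarrow> bool" where
  "kronecker_iso M N \<theta>1 \<theta>2 \<longleftrightarrow>
     linear_between fscale (sp1 M) (sp1 N) \<theta>1 \<and> linear_between fscale (sp2 M) (sp2 N) \<theta>2 \<and>
     bij_betw \<theta>1 (sp1 M) (sp1 N) \<and> bij_betw \<theta>2 (sp2 M) (sp2 N) \<and>
     (\<forall>u\<in>sp1 M. \<theta>2 (arrA M u) = arrA N (\<theta>1 u) \<and> \<theta>2 (arrB M u) = arrB N (\<theta>1 u))"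

definition even_part :: "(nat \<Rightarrow> 'k) \<Rightarrow> nat \<Rightarrow> 'k" where
  "even_part h = (\<lambda>i. h (2 * i))"

definition odd_part :: "(nat \<Rightarrow> 'k) \<Rightarrow> nat \<Rightarrow> 'k" where
  "odd_part h = (\<lambda>i. h (2 * i + 1))"

lemma parts_linear [simp]:
  "even_part (g + h) = even_part g + (even_part h :: nat \<Rightarrow> 'k::field)"
  "odd_part (g + h) = odd_part g + (odd_part h :: nat \<Rightarrow> 'k)"
  "even_part (fscale c h) = fscale c (even_part h)"
  "odd_part (fscale c h) = fscale c (odd_part h)"
  "even_part 0 = (0 :: nat \<Rightarrow> 'k)" "odd_part 0 = (0 :: nat \<Rightarrow> 'k)"
  by (auto simp: even_part_def odd_part_def fun_eq_iff)

lemma parts_eqI: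
  assumes "even_part g = even_part h" "odd_part g = odd_part h"
  shows "g = h"
proof
  fix i
  show "g i = h i"
  proof (cases "even i")
    case True
    then obtain j where "i = 2 * j" by blast
    then show ?thesis using fun_cong[OF assms(1), of j] by (simp add: even_part_def)
  next
    case False
    then obtain j where "i = 2 * j + 1" by (blast elim: oddE)
    then show ?thesis using fun_cong[OF assms(2), of j] by (simp add: odd_part_def)
  qed
qed

lemma parts_exist: obtains h where "even_part h = p" "odd_part h = s"
proof (rule that[of "\<lambda>i. if even i then p (i div 2) else s (i div 2)"])
qed (auto simp: even_part_def odd_part_def)

text \<open>This is the reflection at vertex \<open>2\<close>: the kernel of \<open>(a, b) \<mapsto> A a - B b\<close>, with the two
  projections to the first space of \<open>M\<close>.  A pair of sequences is interleaved into a single one, which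
  keeps the kernel inside \<open>nat \<Rightarrow> 'k\<close>, so that reflection can be iterated.\<close>

definition reflect :: "(nat \<Rightarrow> 'k) kronecker \<Rightarrow> (nat \<Rightarrow> 'k) kronecker" where
  "reflect M = \<lparr>sp1 = {h. even_part h \<in> sp1 M \<and> odd_part h \<in> sp1 M \<and>
                     arrA M (even_part h) = arrB M (odd_part h)},
     sp2 = sp1 M, arrA = odd_part, arrB = even_part\<rparr>"

locale kronecker_rep = finite_field_space scale
  for scale :: "'k::{field,finite} \<Rightarrow> 'v::ab_group_add \<Rightarrow> 'v" +
  fixes M :: "'v kronecker"
  assumes M: "kronecker_module scale M"
begin

lemma sub: "subspace (sp1 M)" "finite (sp1 M)" "subspace (sp2 M)" "finite (sp2 M)"
  using M by (auto simp: kronecker_module_def fin_dim_subspace_iff)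

lemma arr_in: "u \<in> sp1 M \<Longrightarrow> arrA M u \<in> sp2 M" "u \<in> sp1 M \<Longrightarrow> arrB M u \<in> sp2 M"
  using M by (auto simp: kronecker_module_def linear_between_def)

lemma arr_add:
  "u \<in> sp1 M \<Longrightarrow> v \<in> sp1 M \<Longrightarrow> arrA M (u + v) = arrA M u + arrA M v"
  "u \<in> sp1 M \<Longrightarrow> v \<in> sp1 M \<Longrightarrow> arrB M (u + v) = arrB M u + arrB M v"
  using M by (auto simp: kronecker_module_def linear_between_def)

lemma arr_scale:
  "u \<in> sp1 M \<Longrightarrow> arrA M (scale c u) = scale c (arrA M u)"
  "u \<in> sp1 M \<Longrightarrow> arrB M (scale c u) = scale c (arrB M u)"
  using M by (auto simp: kronecker_module_def linear_between_def)

lemma arr_zero: "arrA M 0 = 0" "arrB M 0 = 0"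
  using arr_scale[of 0 0] sub(1) by (simp_all add: subspace_0)

lemma arr_diff:
  assumes "u \<in> sp1 M" "v \<in> sp1 M"
  shows "arrA M (u - v) = arrA M u - arrA M v" "arrB M (u - v) = arrB M u - arrB M v"
  using arr_add[of "u - v" v] assms sub(1) by (simp_all add: subspace_diff)

definition generated :: "'v set \<Rightarrow> 'v set" where
  "generated U = {arrA M a + arrB M b | a b. a \<in> U \<and> b \<in> U}"

lemma generated_submodule:
  assumes U: "subspace U" "U \<subseteq> sp1 M"
  shows "(U, generated U) \<in> submodules scale M"
proof -
  have A: "arrA M a \<in> generated U" if "a \<in> U" for a
  proof -
    have "arrA M a = arrA M a + arrB M 0" "0 \<in> U" using U by (auto simp: arr_zero subspace_0)
    then show ?thesis unfolding generated_def using that by blast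
  qed
  have B: "arrB M a \<in> generated U" if "a \<in> U" for a
  proof -
    have "arrB M a = arrA M 0 + arrB M a" "0 \<in> U" using U by (auto simp: arr_zero subspace_0)
    then show ?thesis unfolding generated_def using that by blast
  qed
  have "subspace (generated U)"
  proof (rule subspaceI)
    show "0 \<in> generated U" using A[of 0] U by (simp add: arr_zero subspace_0)
  next
    fix x y assume "x \<in> generated U" "y \<in> generated U"
    then obtain a b c d where ab: "a \<in> U" "b \<in> U" "c \<in> U" "d \<in> U"
      "x = arrA M a + arrB M b" "y = arrA M c + arrB M d" by (auto simp: generated_def)
    then have "x + y = arrA M (a + c) + arrB M (b + d)" "a + c \<in> U" "b + d \<in> U"
      using U by (auto simp: arr_add subset_iff subspace_add)
    then show "x + y \<in> generated U" unfolding generated_def by blast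
  next
    fix c x assume "x \<in> generated U"
    then obtain a b where ab: "a \<in> U" "b \<in> U" "x = arrA M a + arrB M b" by (auto simp: generated_def)
    then have "scale c x = arrA M (scale c a) + arrB M (scale c b)" "scale c a \<in> U" "scale c b \<in> U"
      using U by (auto simp: arr_scale subset_iff subspace_scale scale_right_distrib)
    then show "scale c x \<in> generated U" unfolding generated_def by blast
  qed
  moreover have "generated U \<subseteq> sp2 M"
    unfolding generated_def using U sub by (auto intro!: subspace_add arr_in)
  ultimately show ?thesis using U A B by (auto simp: submodules_def)
qed

text \<open>Otherwise a complement of the image of both arrows would split off as a module supported at
  vertex \<open>2\<close>.\<close>

lemma generated_sp1:
  assumes ind: "indecomposable scale M" and nz: "sp1 M \<noteq> {0}"
  shows "generated (sp1 M) = sp2 M"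
proof -
  have g: "(sp1 M, generated (sp1 M)) \<in> submodules scale M"
    using sub by (intro generated_submodule) auto
  then have "subspace (generated (sp1 M))" "generated (sp1 M) \<subseteq> sp2 M" by (auto simp: submodules_def)
  then obtain C where C: "subspace C" "C \<subseteq> sp2 M" "direct_sum (sp2 M) (generated (sp1 M)) C"
    using complement_exists sub(3,4) by metis
  have "({0}, C) \<in> submodules scale M"
    using C sub by (auto simp: submodules_def arr_zero subspace_0)
  moreover have "direct_sum (sp1 M) (sp1 M) {0}"
    using sub by (auto simp: direct_sum_def subspace_0)
  ultimately have "(sp1 M, generated (sp1 M)) = ({0}, {0}) \<or> ({0::'v}, C) = ({0}, {0})"
    using ind g C(3) unfolding indecomposable_def by blast
  then have "C = {0}" using nz by simp
  then show ?thesis using C(3) by (simp add: direct_sum_def)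
qed

end

lemma kronecker_repI: "kronecker_module fscale M \<Longrightarrow> kronecker_rep fscale M"
  by (simp add: kronecker_rep_def kronecker_rep_axioms_def F.finite_field_space_axioms)

context
  fixes M :: "(nat \<Rightarrow> 'k::{field,finite}) kronecker"
  assumes M: "kronecker_module fscale M"
begin

interpretation M: kronecker_rep fscale M
  using M by (rule kronecker_repI)

lemma subspace_reflect: "F.subspace (sp1 (reflect M))"
  using M.sub(1)
  by (auto simp: reflect_def F.subspace_def M.arr_zero M.arr_add M.arr_scale)

lemma finite_reflect: "finite (sp1 (reflect M))"
proof (rule finite_imageD)
  show "finite ((\<lambda>h. (even_part h, odd_part h)) ` sp1 (reflect M))"
    by (rule finite_subset[where B = "sp1 M \<times> sp1 M"]) (use M.sub in \<open>auto simp: reflect_def\<close>)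
  show "inj_on (\<lambda>h. (even_part h, odd_part h)) (sp1 (reflect M))"
    by (rule inj_onI) (use parts_eqI in auto)
qed

lemma kronecker_module_reflect: "kronecker_module fscale (reflect M)"
  using subspace_reflect finite_reflect M.sub
  unfolding kronecker_module_def F.fin_dim_subspace_iff linear_between_def
  by (auto simp: reflect_def)

lemma card_reflect: "card (sp1 M) * card (sp1 M) = card (sp1 (reflect M)) * card (M.generated (sp1 M))"
proof -
  let ?f = "\<lambda>(a, b). arrA M a - arrB M b"
  let ?K = "{x \<in> sp1 M \<times> sp1 M. ?f x = 0}"
  have "card (sp1 M \<times> sp1 M) = card ?K * card (?f ` (sp1 M \<times> sp1 M))"
    by (rule card_kernel_image)
       (use M.sub in \<open>auto simp: F.subspace_0 F.subspace_add F.subspace_diff M.arr_add zero_prod_def\<close>)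
  moreover have "bij_betw (\<lambda>h. (even_part h, odd_part h)) (sp1 (reflect M)) ?K"
  proof (rule bij_betw_imageI)
    show "inj_on (\<lambda>h. (even_part h, odd_part h)) (sp1 (reflect M))"
      by (rule inj_onI) (use parts_eqI in auto)
    show "(\<lambda>h. (even_part h, odd_part h)) ` sp1 (reflect M) = ?K"
    proof (intro equalityI subsetI)
      fix x assume x: "x \<in> ?K"
      obtain h where "even_part h = fst x" "odd_part h = snd x" by (rule parts_exist)
      then show "x \<in> (\<lambda>h. (even_part h, odd_part h)) ` sp1 (reflect M)"
        using x by (intro image_eqI[where x = h]) (auto simp: reflect_def)
    qed (auto simp: reflect_def)
  qed
  then have "card (sp1 (reflect M)) = card ?K" by (rule bij_betw_same_card)
  moreover have "?f ` (sp1 M \<times> sp1 M) = M.generated (sp1 M)"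
  proof (intro equalityI subsetI)
    fix x assume "x \<in> ?f ` (sp1 M \<times> sp1 M)"
    then obtain a b where ab: "a \<in> sp1 M" "b \<in> sp1 M" "x = arrA M a - arrB M b" by auto
    then have "x = arrA M a + arrB M (0 - b)" "0 - b \<in> sp1 M"
      using M.sub(1) by (simp_all only: M.arr_diff F.subspace_0 F.subspace_diff M.arr_zero) simp
    then show "x \<in> M.generated (sp1 M)" using ab unfolding M.generated_def by blast
  next
    fix x assume "x \<in> M.generated (sp1 M)"
    then obtain a b where ab: "a \<in> sp1 M" "b \<in> sp1 M" "x = arrA M a + arrB M b"
      by (auto simp: M.generated_def)
    then have "x = ?f (a, 0 - b)" "(a, 0 - b) \<in> sp1 M \<times> sp1 M"
      using M.sub(1)
      by (simp_all only: M.arr_diff F.subspace_0 F.subspace_diff M.arr_zero mem_Times_iff fst_conv snd_conv prod.case) simp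
    then show "x \<in> ?f ` (sp1 M \<times> sp1 M)" by (rule image_eqI)
  qed
  ultimately show ?thesis by (simp add: card_cartesian_product)
qed

text \<open>A coincidence \<open>A a + B b = A c + B d\<close> with \<open>a, b \<in> U1\<close> and \<open>c, d \<in> U2\<close> puts the pair
  \<open>(a - c, d - b)\<close> into the kernel \<open>K1 + K2\<close>.  By uniqueness of components \<open>(a, - b)\<close> belongs to
  \<open>K1\<close>, and hence \<open>A a + B b = 0\<close>.\<close>

lemma direct_sum_generated:
  assumes gen: "M.generated (sp1 M) = sp2 M"
    and 1: "(K1, U1) \<in> submodules fscale (reflect M)" and 2: "(K2, U2) \<in> submodules fscale (reflect M)"
    and K: "direct_sum (sp1 (reflect M)) K1 K2" and U: "direct_sum (sp1 M) U1 U2"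
  shows "direct_sum (sp2 M) (M.generated U1) (M.generated U2)"
proof -
  have sU: "F.subspace U1" "U1 \<subseteq> sp1 M" "F.subspace U2" "U2 \<subseteq> sp1 M"
    using 1 2 by (auto simp: submodules_def reflect_def)
  have K1: "even_part k \<in> U1" "odd_part k \<in> U1" "k \<in> sp1 (reflect M)" if "k \<in> K1" for k
    using 1 that by (auto simp: submodules_def reflect_def)
  have K2: "even_part k \<in> U2" "odd_part k \<in> U2" if "k \<in> K2" for k
    using 2 that by (auto simp: submodules_def reflect_def)
  have U12: "x = 0" if "x \<in> U1" "x \<in> U2" for x
    using that U by (auto simp: direct_sum_def)
  have sg: "F.subspace (M.generated U1)" "M.generated U1 \<subseteq> sp2 M"
     "F.subspace (M.generated U2)" "M.generated U2 \<subseteq> sp2 M"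
    using M.generated_submodule sU by (auto simp: submodules_def)
  have "x = 0" if x: "x \<in> M.generated U1" "x \<in> M.generated U2" for x
  proof -
    obtain a b where ab: "a \<in> U1" "b \<in> U1" "x = arrA M a + arrB M b"
      using x(1) by (auto simp: M.generated_def)
    obtain c d where cd: "c \<in> U2" "d \<in> U2" "x = arrA M c + arrB M d"
      using x(2) by (auto simp: M.generated_def)
    have m: "a \<in> sp1 M" "b \<in> sp1 M" "c \<in> sp1 M" "d \<in> sp1 M" using ab cd sU by auto
    obtain h where h: "even_part h = a - c" "odd_part h = d - b" by (rule parts_exist)
    have "arrA M (a - c) = arrB M (d - b)"
      using ab(3) cd(3) m by (simp add: M.arr_diff algebra_simps)
    then have "h \<in> sp1 (reflect M)"
      using h m M.sub(1) by (auto simp: reflect_def F.subspace_diff)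
    then obtain k1 k2 where k: "k1 \<in> K1" "k2 \<in> K2" "h = k1 + k2"
      using K by (auto simp: direct_sum_def)
    have "a - even_part k1 = c + even_part k2"
      using h(1) k(3) by (simp add: algebra_simps)
    moreover have "a - even_part k1 \<in> U1" "c + even_part k2 \<in> U2"
      using ab cd k K1 K2 sU by (auto simp: F.subspace_diff F.subspace_add)
    ultimately have "a - even_part k1 = 0" by (intro U12) auto
    then have a: "a = even_part k1" by simp
    have "b + odd_part k1 = d - odd_part k2"
      using h(2) k(3) by (simp add: algebra_simps)
    moreover have "b + odd_part k1 \<in> U1" "d - odd_part k2 \<in> U2"
      using ab cd k K1 K2 sU by (auto simp: F.subspace_diff F.subspace_add)
    ultimately have "b + odd_part k1 = 0" by (intro U12) auto
    then have b: "b = 0 - odd_part k1" by (simp add: eq_neg_iff_add_eq_0)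
    have "odd_part k1 \<in> sp1 M" using K1(2)[OF k(1)] sU by auto
    then have "arrB M b = - arrB M (odd_part k1)"
      unfolding b using M.sub(1) by (simp only: M.arr_diff F.subspace_0 M.arr_zero) simp
    then show ?thesis using K1(3)[OF k(1)] ab(3) a by (simp add: reflect_def)
  qed
  then have int: "M.generated U1 \<inter> M.generated U2 = {0}"
    using sg by (auto simp: F.subspace_0)
  have "sp2 M = {u + u' | u u'. u \<in> M.generated U1 \<and> u' \<in> M.generated U2}"
  proof (intro equalityI subsetI)
    fix x assume "x \<in> sp2 M"
    then obtain a b where ab: "a \<in> sp1 M" "b \<in> sp1 M" "x = arrA M a + arrB M b"
      unfolding gen[symmetric] by (auto simp: M.generated_def)
    obtain a1 a2 where a: "a1 \<in> U1" "a2 \<in> U2" "a = a1 + a2" using ab U by (auto simp: direct_sum_def)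
    obtain b1 b2 where b: "b1 \<in> U1" "b2 \<in> U2" "b = b1 + b2" using ab U by (auto simp: direct_sum_def)
    have "x = (arrA M a1 + arrB M b1) + (arrA M a2 + arrB M b2)"
      using ab(3) a b sU by (simp add: M.arr_add subset_iff)
    moreover have "arrA M a1 + arrB M b1 \<in> M.generated U1" "arrA M a2 + arrB M b2 \<in> M.generated U2"
      using a b by (auto simp: M.generated_def)
    ultimately show "x \<in> {u + u' | u u'. u \<in> M.generated U1 \<and> u' \<in> M.generated U2}" by blast
  next
    fix x assume "x \<in> {u + u' | u u'. u \<in> M.generated U1 \<and> u' \<in> M.generated U2}"
    then show "x \<in> sp2 M" using sg M.sub(3) by (auto simp: subset_iff F.subspace_add)
  qed
  then show ?thesis using int by (simp add: direct_sum_def)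
qed

lemma indecomposable_reflect:
  assumes ind: "indecomposable fscale M" and nz: "sp1 M \<noteq> {0}"
  shows "indecomposable fscale (reflect M)"
proof -
  have gen: "M.generated (sp1 M) = sp2 M" using ind nz by (rule M.generated_sp1)
  have K0: "K = {0}" if "(K, {0}) \<in> submodules fscale (reflect M)" for K
  proof -
    have "h = 0" if h: "h \<in> K" for h
    proof -
      have "odd_part h = 0" "even_part h = 0"
        using \<open>(K, {0}) \<in> _\<close> h by (auto simp: submodules_def reflect_def)
      then show ?thesis using parts_eqI[of h 0] by simp
    qed
    moreover have "0 \<in> K" using that by (simp add: submodules_def F.subspace_0)
    ultimately show ?thesis by blast
  qed
  have "(K1, U1) = ({0}, {0}) \<or> (K2, U2) = ({0}, {0})"
    if 1: "(K1, U1) \<in> submodules fscale (reflect M)" and 2: "(K2, U2) \<in> submodules fscale (reflect M)"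
    and K: "direct_sum (sp1 (reflect M)) K1 K2" and U: "direct_sum (sp2 (reflect M)) U1 U2"
    for K1 U1 K2 U2
  proof -
    have U': "direct_sum (sp1 M) U1 U2" using U by (simp add: reflect_def)
    have sU: "F.subspace U1" "U1 \<subseteq> sp1 M" "F.subspace U2" "U2 \<subseteq> sp1 M"
      using 1 2 by (auto simp: submodules_def reflect_def)
    have "(U1, M.generated U1) = ({0}, {0}) \<or> (U2, M.generated U2) = ({0}, {0})"
      using ind M.generated_submodule[OF sU(1,2)] M.generated_submodule[OF sU(3,4)] U'
        direct_sum_generated[OF gen 1 2 K U'] unfolding indecomposable_def by blast
    then show ?thesis using K0 1 2 by auto
  qed
  then show ?thesis
    using kronecker_module_reflect nz unfolding indecomposable_def by (auto simp: reflect_def)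
qed

text \<open>The reflected module records the relations \<open>A u\<^sub>i\<^sub>+\<^sub>1 = B u\<^sub>i\<close> for the basis
  \<open>u\<^sub>i = \<theta>2 t\<^sup>i\<close>.  They allow \<open>\<theta>2\<close> to be extended to \<open>\<psi>\<close> on polynomials of degree one more by
  \<open>t\<^sup>i \<mapsto> A u\<^sub>i\<close> and \<open>t\<^sup>i\<^sup>+\<^sup>1 \<mapsto> B u\<^sub>i\<close>; the two rules agree where both apply.  Since the two
  arrows generate the second space, \<open>\<psi>\<close> is onto, and then bijective by the count of elements.\<close>

lemma preprojective_from_reflect:
  assumes gen: "M.generated (sp1 M) = sp2 M" and card: "card (sp2 M) = CARD('k) ^ Suc (Suc l)"
    and iso: "kronecker_iso (preprojective l) (reflect M) \<theta>1 \<theta>2"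
  obtains \<psi> where "kronecker_iso (preprojective (Suc l)) M \<theta>2 \<psi>"
proof -
  have \<theta>2: "\<And>f. f \<in> seqs (Suc l) \<Longrightarrow> \<theta>2 f \<in> sp1 M"
      "\<And>f g. f \<in> seqs (Suc l) \<Longrightarrow> g \<in> seqs (Suc l) \<Longrightarrow> \<theta>2 (f + g) = \<theta>2 f + \<theta>2 g"
      "\<And>c f. f \<in> seqs (Suc l) \<Longrightarrow> \<theta>2 (fscale c f) = fscale c (\<theta>2 f)"
    and lin2: "linear_between fscale (seqs (Suc l)) (sp1 M) \<theta>2"
    and b2: "bij_betw \<theta>2 (seqs (Suc l)) (sp1 M)"
    and \<theta>1: "\<And>f. f \<in> seqs l \<Longrightarrow> \<theta>1 f \<in> sp1 (reflect M)"
    and arr: "\<And>f. f \<in> seqs l \<Longrightarrow> \<theta>2 f = odd_part (\<theta>1 f)" "\<And>f. f \<in> seqs l \<Longrightarrow> \<theta>2 (shift f) = even_part (\<theta>1 f)"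
    using iso by (auto simp: kronecker_iso_def preprojective_def linear_between_def reflect_def)
  have rel: "arrA M (even_part h) = arrB M (odd_part h)" if "h \<in> sp1 (reflect M)" for h
    using that by (simp add: reflect_def)
  define hd where "hd f = (\<lambda>i::nat. if i = 0 then f 0 else 0)" for f :: "nat \<Rightarrow> 'k"
  define tl where "tl f = (\<lambda>i. f (Suc i))" for f :: "nat \<Rightarrow> 'k"
  have hd_tl: "hd f + shift (tl f) = f" for f :: "nat \<Rightarrow> 'k"
    by (auto simp: hd_def tl_def shift_def fun_eq_iff split: nat.splits)
  have hd: "hd f \<in> seqs (Suc l)" for f by (simp add: hd_def seqs_def)
  have tl: "tl f \<in> seqs n" if "f \<in> seqs (Suc n)" for f n using that by (simp add: tl_def seqs_def)
  have hd_lin: "hd (f + g) = hd f + hd g" "hd (fscale c f) = fscale c (hd f)" for f g c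
    by (auto simp: hd_def fun_eq_iff)
  have tl_lin: "tl (f + g) = tl f + tl g" "tl (fscale c f) = fscale c (tl f)" for f g c
    by (auto simp: tl_def fun_eq_iff)
  \<comment> \<open>A polynomial is \<open>f = hd f + t tl f\<close>; its constant term goes through \<open>A\<close>, the rest through \<open>B\<close>.\<close>
  define \<psi> where "\<psi> f = arrA M (\<theta>2 (hd f)) + arrB M (\<theta>2 (tl f))" for f
  have lin: "linear_between fscale (seqs (Suc (Suc l))) (sp2 M) \<psi>"
    unfolding linear_between_def \<psi>_def
    using M.sub(3)
    by (auto simp: hd_lin tl_lin hd tl \<theta>2 M.arr_add M.arr_scale M.arr_in F.subspace_add
        F.scale_right_distrib)
  have A: "\<psi> f = arrA M (\<theta>2 f)" if f: "f \<in> seqs (Suc l)" for f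
  proof -
    have t: "tl f \<in> seqs l" using f by (rule tl)
    have st: "shift (tl f) \<in> seqs (Suc l)" using t by (simp add: shift_in_seqs_iff)
    have "arrB M (\<theta>2 (tl f)) = arrA M (\<theta>2 (shift (tl f)))"
      using arr[OF t] rel[OF \<theta>1[OF t]] by simp
    then have "\<psi> f = arrA M (\<theta>2 (hd f + shift (tl f)))"
      by (simp add: \<psi>_def M.arr_add \<theta>2 hd st)
    then show ?thesis by (simp add: hd_tl)
  qed
  have B: "\<psi> (shift f) = arrB M (\<theta>2 f)" if f: "f \<in> seqs (Suc l)" for f
  proof -
    have "hd (shift f) = fscale 0 0" "tl (shift f) = f" by (auto simp: hd_def tl_def fun_eq_iff)
    moreover have "\<theta>2 (fscale 0 0) = 0" using \<theta>2(3)[of 0 0] by (simp add: seqs_def)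
    ultimately show ?thesis by (simp add: \<psi>_def M.arr_zero)
  qed
  have "sp2 M \<subseteq> \<psi> ` seqs (Suc (Suc l))"
  proof
    fix x assume "x \<in> sp2 M"
    then obtain a b where ab: "a \<in> sp1 M" "b \<in> sp1 M" "x = arrA M a + arrB M b"
      unfolding gen[symmetric] by (auto simp: M.generated_def)
    have "a \<in> \<theta>2 ` seqs (Suc l)" "b \<in> \<theta>2 ` seqs (Suc l)"
      using ab b2 by (auto simp: bij_betw_def)
    then obtain f g where fg: "f \<in> seqs (Suc l)" "a = \<theta>2 f" "g \<in> seqs (Suc l)" "b = \<theta>2 g"
      by blast
    have m: "f \<in> seqs (Suc (Suc l))" "shift g \<in> seqs (Suc (Suc l))"
      using fg seqs_mono[of "Suc l" "Suc (Suc l)"] by (auto simp: shift_in_seqs_iff)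
    then have "\<psi> (f + shift g) = x"
      using lin fg ab by (simp add: linear_between_def A B)
    moreover have "f + shift g \<in> seqs (Suc (Suc l))"
      using m subspace_seqs by (rule_tac F.subspace_add)
    ultimately show "x \<in> \<psi> ` seqs (Suc (Suc l))" by blast
  qed
  then have im: "\<psi> ` seqs (Suc (Suc l)) = sp2 M"
    using lin by (auto simp: linear_between_def)
  then have "bij_betw \<psi> (seqs (Suc (Suc l))) (sp2 M)"
    using card by (auto simp: bij_betw_def card_seqs finite_seqs intro!: eq_card_imp_inj_on)
  then have "kronecker_iso (preprojective (Suc l)) M \<theta>2 \<psi>"
    using lin lin2 b2 A B by (simp add: kronecker_iso_def preprojective_def)
  then show thesis by (rule that)
qed

end

text \<open>Reflection lowers the dimension vector \<open>(l + 1, l + 2)\<close> to \<open>(l, l + 1)\<close> and keeps the module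
  indecomposable, so induction on \<open>l\<close> reduces everything to the simple module at vertex \<open>2\<close>.\<close>

theorem indecomposable_preprojective:
  fixes M :: "(nat \<Rightarrow> 'k::{field,finite}) kronecker"
  assumes "indecomposable fscale M" "dim_vector fscale M = (l, Suc l)"
  shows "\<exists>\<theta>1 \<theta>2. kronecker_iso (preprojective l) M \<theta>1 \<theta>2"
  using assms
proof (induction l arbitrary: M)
  case 0
  note fscale_apply [simp del]
  from 0 have M: "kronecker_module fscale M" by (simp add: indecomposable_def)
  interpret M: kronecker_rep fscale M using M by (rule kronecker_repI)
  have c: "card (sp1 M) = 1" "card (sp2 M) = CARD('k)"
    using 0(2) F.card_subspace[OF M.sub(1,2)] F.card_subspace[OF M.sub(3,4)] by (auto simp: dim_vector_def)
  have U: "sp1 M = {0}"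
    using c(1) F.subspace_0[OF M.sub(1)] by (auto simp: card_1_singleton_iff)
  have "sp2 M \<noteq> {0}" using c F.card_field_gt_1 by auto
  then obtain w where w: "w \<in> sp2 M" "w \<noteq> 0" using M.sub(3) F.subspace_0 by blast
  let ?\<theta> = "\<lambda>f::nat \<Rightarrow> 'k. fscale (f 0) w"
  have inj: "inj_on ?\<theta> (seqs (Suc 0))"
  proof (rule inj_onI)
    fix f g :: "nat \<Rightarrow> 'k"
    assume fg: "f \<in> seqs (Suc 0)" "g \<in> seqs (Suc 0)" "fscale (f 0) w = fscale (g 0) w"
    then have "f 0 = g 0" using w by simp
    moreover have "f i = 0" "g i = 0" if "i > 0" for i using fg that by (auto simp: seqs_def Suc_le_eq)
    ultimately show "f = g" by (metis ext neq0_conv)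
  qed
  have sub: "?\<theta> ` seqs (Suc 0) \<subseteq> sp2 M" using w M.sub by (auto intro: F.subspace_scale)
  have "card (?\<theta> ` seqs (Suc 0)) = card (sp2 M)" using card_image[OF inj] c by (simp add: card_seqs)
  then have "bij_betw ?\<theta> (seqs (Suc 0)) (sp2 M)"
    using inj sub card_subset_eq[OF M.sub(4)] by (auto simp: bij_betw_def)
  moreover have "linear_between fscale (seqs (Suc 0)) (sp2 M) ?\<theta>"
    using sub by (auto simp: linear_between_def fscale_apply F.scale_left_distrib)
  moreover have "shift 0 = (0 :: nat \<Rightarrow> 'k)" by (auto simp: shift_def fun_eq_iff split: nat.splits)
  ultimately have "kronecker_iso (preprojective 0) M (\<lambda>_. 0) ?\<theta>"
    by (auto simp: kronecker_iso_def preprojective_def U M.arr_zero linear_between_def)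
  then show ?case by blast
next
  case (Suc l)
  note fscale_apply [simp del]
  from Suc.prems have M: "kronecker_module fscale M" by (simp add: indecomposable_def)
  interpret M: kronecker_rep fscale M using M by (rule kronecker_repI)
  have c: "card (sp1 M) = CARD('k) ^ Suc l" "card (sp2 M) = CARD('k) ^ Suc (Suc l)"
    using Suc.prems(2) F.card_subspace[OF M.sub(1,2)] F.card_subspace[OF M.sub(3,4)]
    by (auto simp: dim_vector_def)
  have q: "1 < CARD('k)" by (rule F.card_field_gt_1)
  then have "1 < CARD('k) ^ Suc l" by (rule one_less_power) simp
  then have nz: "sp1 M \<noteq> {0}" using c by auto
  have gen: "M.generated (sp1 M) = sp2 M" using Suc.prems(1) nz by (rule M.generated_sp1)
  \<comment> \<open>Rank and nullity: \<open>q\<^sup>l\<^sup>+\<^sup>1 q\<^sup>l\<^sup>+\<^sup>1 = |K| q\<^sup>l\<^sup>+\<^sup>2\<close> for the kernel \<open>K\<close>.\<close>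
  have "CARD('k) ^ Suc (Suc l) * CARD('k) ^ l = CARD('k) ^ Suc (Suc l) * card (sp1 (reflect M))"
    using card_reflect[OF M] c gen by (simp add: power_add[symmetric] mult.commute)
  then have "card (sp1 (reflect M)) = CARD('k) ^ l" using q by simp
  then have "F.dim (sp1 (reflect M)) = l"
    by (subst F.dim_eq_iff_card) (auto simp: subspace_reflect finite_reflect M)
  then have "dim_vector fscale (reflect M) = (l, Suc l)"
    using Suc.prems(2) by (simp add: dim_vector_def) (simp add: reflect_def)
  with Suc.IH indecomposable_reflect[OF M Suc.prems(1) nz]
  obtain \<theta>1 \<theta>2 where "kronecker_iso (preprojective l) (reflect M) \<theta>1 \<theta>2" by blast
  then show ?case using preprojective_from_reflect[OF M gen c(2)] by blast
qed


section \<open>Submodules of the preprojective modules\<close>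

lemma linear_bij_image:
  fixes \<theta> :: "(nat \<Rightarrow> 'k::{field,finite}) \<Rightarrow> nat \<Rightarrow> 'k"
  assumes lin: "linear_between fscale A B \<theta>" and bij: "bij_betw \<theta> A B" and fin: "finite A"
    and U: "F.subspace U" "U \<subseteq> A"
  shows "F.subspace (\<theta> ` U)" "F.dim (\<theta> ` U) = F.dim U"
proof -
  have \<theta>: "\<theta> (u + v) = \<theta> u + \<theta> v" "\<theta> (fscale c u) = fscale c (\<theta> u)" if "u \<in> U" "v \<in> U" for u v c
    using that U(2) lin by (auto simp: linear_between_def subset_iff)
  have "\<theta> (fscale 0 0) = fscale 0 (\<theta> 0)" using \<theta>(2)[of 0 0 0] U(1) by (simp only: F.subspace_0)
  then have "\<theta> 0 = 0" by (simp only: F.scale_zero_left)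
  show sub: "F.subspace (\<theta> ` U)"
  proof (intro F.subspaceI)
    show "0 \<in> \<theta> ` U" using \<open>\<theta> 0 = 0\<close> F.subspace_0[OF U(1)] by (metis imageI)
  next
    fix y z assume "y \<in> \<theta> ` U" "z \<in> \<theta> ` U"
    then obtain u v where "u \<in> U" "v \<in> U" "y = \<theta> u" "z = \<theta> v" by blast
    then have "y + z = \<theta> (u + v)" "u + v \<in> U" using U(1) by (auto simp: \<theta> F.subspace_add)
    then show "y + z \<in> \<theta> ` U" by (rule image_eqI)
  next
    fix c y assume "y \<in> \<theta> ` U"
    then obtain u where "u \<in> U" "y = \<theta> u" by blast
    then have "fscale c y = \<theta> (fscale c u)" "fscale c u \<in> U" using U(1) by (auto simp: \<theta> F.subspace_scale)
    then show "fscale c y \<in> \<theta> ` U" by (rule image_eqI)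
  qed
  have "inj_on \<theta> U" using bij U(2) by (auto simp: bij_betw_def intro: inj_on_subset)
  then have "card (\<theta> ` U) = card U" by (rule card_image)
  moreover have "finite U" using U(2) fin by (rule finite_subset)
  ultimately show "F.dim (\<theta> ` U) = F.dim U"
    using U(1) sub F.card_subspace[of U] by (subst F.dim_eq_iff_card) auto
qed

lemma subspace_linear_preimage:
  fixes \<theta> :: "(nat \<Rightarrow> 'k::{field,finite}) \<Rightarrow> nat \<Rightarrow> 'k"
  assumes lin: "linear_between fscale A B \<theta>" and A: "F.subspace A" and P: "F.subspace P"
  shows "F.subspace {u \<in> A. \<theta> u \<in> P}"
proof (rule F.subspaceI)
  have "\<theta> (fscale 0 0) = fscale 0 (\<theta> 0)" using lin F.subspace_0[OF A] by (simp only: linear_between_def)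
  then have "\<theta> 0 = 0" by (simp only: F.scale_zero_left)
  then show "0 \<in> {u \<in> A. \<theta> u \<in> P}" using A P by (simp add: F.subspace_0)
qed (use lin A P in \<open>auto simp: linear_between_def F.subspace_add F.subspace_scale\<close>)

lemma card_Gr_iso:
  fixes M N :: "(nat \<Rightarrow> 'k::{field,finite}) kronecker"
  assumes M: "kronecker_module fscale M" and iso: "kronecker_iso M N \<theta>1 \<theta>2"
  shows "card (Gr fscale e M) = card (Gr fscale e N)"
proof -
  interpret M: kronecker_rep fscale M using M by (rule kronecker_repI)
  have l1: "linear_between fscale (sp1 M) (sp1 N) \<theta>1" and l2: "linear_between fscale (sp2 M) (sp2 N) \<theta>2"
    and b1: "bij_betw \<theta>1 (sp1 M) (sp1 N)" and b2: "bij_betw \<theta>2 (sp2 M) (sp2 N)"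
    and arr: "\<And>u. u \<in> sp1 M \<Longrightarrow> arrA N (\<theta>1 u) = \<theta>2 (arrA M u)"
      "\<And>u. u \<in> sp1 M \<Longrightarrow> arrB N (\<theta>1 u) = \<theta>2 (arrB M u)"
    using iso by (auto simp: kronecker_iso_def)
  note im1 = linear_bij_image[OF l1 b1 M.sub(2)] and im2 = linear_bij_image[OF l2 b2 M.sub(4)]
  note pre1 = subspace_linear_preimage[OF l1 M.sub(1)] and pre2 = subspace_linear_preimage[OF l2 M.sub(3)]
  have s1: "\<theta>1 ` {u \<in> sp1 M. \<theta>1 u \<in> P} = P" if "P \<subseteq> sp1 N" for P
    using that b1 by (auto simp: bij_betw_def)
  have s2: "\<theta>2 ` {u \<in> sp2 M. \<theta>2 u \<in> P} = P" if "P \<subseteq> sp2 N" for P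
    using that b2 by (auto simp: bij_betw_def)
  have r1: "{u \<in> sp1 M. \<theta>1 u \<in> \<theta>1 ` U} = U" if "U \<subseteq> sp1 M" for U
    using that b1 inj_on_image_mem_iff[of \<theta>1 "sp1 M"] by (auto simp: bij_betw_def)
  have r2: "{u \<in> sp2 M. \<theta>2 u \<in> \<theta>2 ` U} = U" if "U \<subseteq> sp2 M" for U
    using that b2 inj_on_image_mem_iff[of \<theta>2 "sp2 M"] by (auto simp: bij_betw_def)
  let ?F = "\<lambda>(U, W). (\<theta>1 ` U, \<theta>2 ` W)"
    and ?G = "\<lambda>(P, Q). ({u \<in> sp1 M. \<theta>1 u \<in> P}, {w \<in> sp2 M. \<theta>2 w \<in> Q})"
  have "bij_betw ?F (Gr fscale e M) (Gr fscale e N)"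
  proof (rule bij_betw_byWitness[where f' = ?G])
    show "\<forall>a\<in>Gr fscale e M. ?G (?F a) = a"
      using r1 r2 by (auto simp: Gr_def submodules_def)
    show "\<forall>a\<in>Gr fscale e N. ?F (?G a) = a"
      using s1 s2 by (auto simp: Gr_def submodules_def)
    show "?F ` Gr fscale e M \<subseteq> Gr fscale e N"
    proof clarify
      fix U W assume "(U, W) \<in> Gr fscale e M"
      then have UW: "F.subspace U" "F.subspace W" "U \<subseteq> sp1 M" "W \<subseteq> sp2 M" "arrA M ` U \<subseteq> W"
        "arrB M ` U \<subseteq> W" "F.dim U = fst e" "F.dim W = snd e" by (auto simp: Gr_def submodules_def)
      have "\<theta>1 ` U \<subseteq> sp1 N" "\<theta>2 ` W \<subseteq> sp2 N" using l1 l2 UW by (auto simp: linear_between_def subset_iff)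
      moreover have "arrA N (\<theta>1 u) \<in> \<theta>2 ` W" "arrB N (\<theta>1 u) \<in> \<theta>2 ` W" if "u \<in> U" for u
        using that UW by (auto simp: arr subset_iff)
      ultimately show "(\<theta>1 ` U, \<theta>2 ` W) \<in> Gr fscale e N"
        using UW im1[OF UW(1,3)] im2[OF UW(2,4)] by (auto simp: Gr_def submodules_def)
    qed
    show "?G ` Gr fscale e N \<subseteq> Gr fscale e M"
    proof clarify
      fix P Q assume "(P, Q) \<in> Gr fscale e N"
      then have PQ: "F.subspace P" "F.subspace Q" "P \<subseteq> sp1 N" "Q \<subseteq> sp2 N" "arrA N ` P \<subseteq> Q"
        "arrB N ` P \<subseteq> Q" "F.dim P = fst e" "F.dim Q = snd e" by (auto simp: Gr_def submodules_def)
      have "\<theta>2 (arrA M u) \<in> Q" "\<theta>2 (arrB M u) \<in> Q" if "u \<in> sp1 M" "\<theta>1 u \<in> P" for u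
        using that PQ by (auto simp flip: arr)
      then show "({u \<in> sp1 M. \<theta>1 u \<in> P}, {w \<in> sp2 M. \<theta>2 w \<in> Q}) \<in> Gr fscale e M"
        using PQ pre1[OF PQ(1)] pre2[OF PQ(2)] im1(2)[OF pre1[OF PQ(1)]] im2(2)[OF pre2[OF PQ(2)]]
        by (auto simp: Gr_def submodules_def s1 s2 M.arr_in)
    qed
  qed
  then show ?thesis by (rule bij_betw_same_card)
qed

lemma kronecker_module_preprojective: "kronecker_module fscale (preprojective l :: (nat \<Rightarrow> 'k::{field,finite}) kronecker)"
  using seqs_mono[of l "Suc l"]
  by (auto simp: kronecker_module_def preprojective_def F.fin_dim_subspace_iff subspace_seqs finite_seqs
      linear_between_def shift_in_seqs_iff shift_add shift_fscale)

text \<open>The submodules of dimension vector \<open>(a, b)\<close> of the preprojective module of dimension vector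
  \<open>(j - 1, j)\<close>.  The index is shifted so that \<open>j = 0\<close>, where the truncated \<open>j - 1\<close> is \<open>0\<close>, gives the
  single pair \<open>({0}, {0})\<close>: this is the initial value which lets the recurrence start at \<open>j = 0\<close>.
  Integer dimensions spare side conditions in that recurrence.\<close>

definition preprojective_subs ::
  "nat \<Rightarrow> int \<Rightarrow> int \<Rightarrow> ((nat \<Rightarrow> 'k::{field,finite}) set \<times> (nat \<Rightarrow> 'k) set) set" where
  "preprojective_subs j a b = {(U, W). F.subspace U \<and> F.subspace W \<and> U \<subseteq> seqs (j - 1) \<and> W \<subseteq> seqs j \<and>
     U \<subseteq> W \<and> shift ` U \<subseteq> W \<and> int (F.dim U) = a \<and> int (F.dim W) = b}"

lemma Gr_preprojective:
  "Gr fscale (e1, e2) (preprojective l) = preprojective_subs (Suc l) (int e1) (int e2)"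
  by (auto simp: Gr_def submodules_def preprojective_subs_def preprojective_def)

lemma finite_preprojective_subs: "finite (preprojective_subs j a b)"
  by (rule finite_subset[where B = "Pow (seqs (j - 1)) \<times> Pow (seqs j)"])
     (auto simp: preprojective_subs_def finite_seqs)

text \<open>The condition on \<open>U\<close> takes care of itself, as \<open>t U \<subseteq> W\<close> bounds the degrees in \<open>U\<close>.\<close>

lemma preprojective_subs_restrict:
  "{(U, W) \<in> preprojective_subs (Suc j) a b. W \<subseteq> seqs j} = preprojective_subs j a b"
proof -
  have "U \<subseteq> seqs (j - 1)" if UW: "U \<subseteq> W" "shift ` U \<subseteq> W" "W \<subseteq> seqs j" for U W :: "(nat \<Rightarrow> 'a) set"
  proof (cases j)
    case 0
    then show ?thesis using UW by auto
  next
    case (Suc i)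
    have "f \<in> seqs i" if "f \<in> U" for f
    proof -
      have "shift f \<in> seqs (Suc i)" using that UW Suc by blast
      then show ?thesis by (simp add: shift_in_seqs_iff)
    qed
    then show ?thesis using Suc by auto
  qed
  moreover have "U \<subseteq> seqs j" if "U \<subseteq> seqs (j - 1)" for U :: "(nat \<Rightarrow> 'a) set"
    using that seqs_mono[of "j - 1" j] by auto
  moreover have "W \<subseteq> seqs (Suc j)" if "W \<subseteq> seqs j" for W :: "(nat \<Rightarrow> 'a) set"
    using that seqs_mono[of j "Suc j"] by auto
  ultimately have "(U, W) \<in> preprojective_subs (Suc j) a b \<and> W \<subseteq> seqs j \<longleftrightarrow>
      (U, W) \<in> preprojective_subs j a b" for U W :: "(nat \<Rightarrow> 'a) set"
    unfolding preprojective_subs_def diff_Suc_1 mem_Collect_eq prod.case by meson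
  then show ?thesis by (simp add: set_eq_iff split_paired_all)
qed

text \<open>For \<open>W \<subseteq> seqs (Suc n)\<close> these are the monic polynomials of degree \<open>n\<close> in \<open>W\<close>.\<close>

definition tops :: "nat \<Rightarrow> (nat \<Rightarrow> 'k::one) set \<Rightarrow> (nat \<Rightarrow> 'k) set" where
  "tops n W = {x \<in> W. x n = 1}"

text \<open>When \<open>x\<close> is monic of degree \<open>n\<close> and \<open>W\<close> consists of polynomials of smaller degree, this is
  \<open>W + k x\<close>.\<close>

definition adjoin :: "nat \<Rightarrow> (nat \<Rightarrow> 'k::field) \<Rightarrow> (nat \<Rightarrow> 'k) set \<Rightarrow> (nat \<Rightarrow> 'k) set" where
  "adjoin n x W = {y. y - fscale (y n) x \<in> W}"

lemma tops_empty: "W \<subseteq> seqs n \<Longrightarrow> tops n W = ({} :: (nat \<Rightarrow> 'k::field) set)"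
  by (auto simp: tops_def seqs_def)

lemma seqs_Int: "W \<subseteq> seqs (Suc n) \<Longrightarrow> {y \<in> W. y n = 0} = W \<inter> seqs n"
  using seqs_kernel[of n] by blast

context
  fixes W :: "(nat \<Rightarrow> 'k::{field,finite}) set" and n :: nat
  assumes W: "F.subspace W" "W \<subseteq> seqs (Suc n)"
begin

lemma finite_subspace_of_seqs: "finite W"
  using W(2) finite_seqs by (rule finite_subset)

lemma dim_top:
  assumes "\<not> W \<subseteq> seqs n"
  shows "F.dim W = Suc (F.dim (W \<inter> seqs n))"
proof -
  have "\<exists>y\<in>W. y n \<noteq> 0" using assms seqs_Int[OF W(2)] by blast
  then have "card W = card {y \<in> W. y n = 0} * CARD('k)"
    by (intro F.card_functional_kernel) (auto simp: W finite_subspace_of_seqs)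
  then have "card W = card (W \<inter> seqs n) * CARD('k)" by (simp add: seqs_Int[OF W(2)])
  then show ?thesis
    using F.card_subspace[of "W \<inter> seqs n"] finite_subspace_of_seqs W
    by (subst F.dim_eq_iff_card) (auto simp: F.subspace_inter subspace_seqs)
qed

lemma tops_nonempty:
  assumes "\<not> W \<subseteq> seqs n"
  obtains x where "x \<in> tops n W"
proof -
  obtain y where y: "y \<in> W" "y n \<noteq> 0" using assms seqs_Int[OF W(2)] by blast
  have "fscale (inverse (y n)) y \<in> tops n W"
    using y W(1) F.subspace_scale by (auto simp: tops_def)
  then show thesis by (rule that)
qed

lemma card_tops:
  assumes "\<not> W \<subseteq> seqs n"
  shows "card (tops n W) = CARD('k) ^ F.dim (W \<inter> seqs n)"
proof -
  obtain x where x: "x \<in> tops n W" using assms by (rule tops_nonempty)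
  have "bij_betw (\<lambda>y. y - x) (tops n W) {y \<in> W. y n = 0}"
    by (rule bij_betw_byWitness[where f' = "\<lambda>y. y + x"])
       (use x W(1) F.subspace_diff F.subspace_add in \<open>auto simp: tops_def\<close>)
  then have "card (tops n W) = card (W \<inter> seqs n)"
    by (simp add: seqs_Int[OF W(2)] bij_betw_same_card)
  then show ?thesis
    using finite_subspace_of_seqs W by (simp add: F.card_subspace F.subspace_inter subspace_seqs)
qed

text \<open>A space containing a monic \<open>x\<close> of degree \<open>n\<close> is recovered from \<open>x\<close> and from its polynomials of
  degree less than \<open>n\<close>.  Together with \<open>adjoin_Int\<close> this gives the two inverse maps of the
  bijections below.\<close>

lemma adjoin_restrict:
  assumes "x \<in> tops n W"
  shows "adjoin n x (W \<inter> seqs n) = W"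
proof (intro equalityI subsetI)
  have x: "x \<in> W" "x n = 1" using assms by (auto simp: tops_def)
  fix y assume "y \<in> adjoin n x (W \<inter> seqs n)"
  then have "y - fscale (y n) x \<in> W" by (simp add: adjoin_def)
  then have "(y - fscale (y n) x) + fscale (y n) x \<in> W"
    using x W(1) by (intro F.subspace_add F.subspace_scale)
  then show "y \<in> W" by simp
next
  have x: "x \<in> W" "x n = 1" using assms by (auto simp: tops_def)
  fix y assume "y \<in> W"
  then have "y - fscale (y n) x \<in> W" using x W(1) by (intro F.subspace_diff F.subspace_scale)
  moreover have "(y - fscale (y n) x) n = 0" using x by simp
  ultimately have "y - fscale (y n) x \<in> W \<inter> seqs n" using seqs_Int[OF W(2)] by blast
  then show "y \<in> adjoin n x (W \<inter> seqs n)" by (simp add: adjoin_def)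
qed

end

context
  fixes W :: "(nat \<Rightarrow> 'k::{field,finite}) set" and n :: nat and x :: "nat \<Rightarrow> 'k"
  assumes W: "F.subspace W" "W \<subseteq> seqs n" and x: "x \<in> seqs (Suc n)" "x n = 1"
begin

lemma subspace_adjoin: "F.subspace (adjoin n x W)"
proof (rule F.subspaceI)
  show "0 \<in> adjoin n x W" using F.subspace_0[OF W(1)] by (simp add: adjoin_def)
next
  fix y z assume "y \<in> adjoin n x W" "z \<in> adjoin n x W"
  then have "(y - fscale (y n) x) + (z - fscale (z n) x) \<in> W"
    using W(1) by (auto simp: adjoin_def intro: F.subspace_add)
  moreover have "(y - fscale (y n) x) + (z - fscale (z n) x) = (y + z) - fscale ((y + z) n) x"
    by (auto simp: fun_eq_iff algebra_simps)
  ultimately show "y + z \<in> adjoin n x W" by (simp add: adjoin_def)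
next
  fix c y assume "y \<in> adjoin n x W"
  then have "fscale c (y - fscale (y n) x) \<in> W"
    using W(1) by (auto simp: adjoin_def intro: F.subspace_scale)
  moreover have "fscale c (y - fscale (y n) x) = fscale c y - fscale (fscale c y n) x"
    by (auto simp: fun_eq_iff algebra_simps)
  ultimately show "fscale c y \<in> adjoin n x W" by (simp add: adjoin_def)
qed

lemma adjoin_subset: "adjoin n x W \<subseteq> seqs (Suc n)"
proof
  fix y assume "y \<in> adjoin n x W"
  then have "y - fscale (y n) x \<in> seqs (Suc n)"
    using W(2) seqs_mono[of n "Suc n"] by (auto simp: adjoin_def)
  then have "(y - fscale (y n) x) + fscale (y n) x \<in> seqs (Suc n)"
    using x by (intro F.subspace_add F.subspace_scale subspace_seqs)
  then show "y \<in> seqs (Suc n)" by simp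
qed

lemma adjoin_tops: "x \<in> tops n (adjoin n x W)"
proof -
  have "x - fscale (x n) x = 0" using x by (auto simp: fun_eq_iff)
  then show ?thesis using x F.subspace_0[OF W(1)] by (auto simp: tops_def adjoin_def)
qed

lemma adjoin_Int: "adjoin n x W \<inter> seqs n = W"
proof -
  have "y - fscale (y n) x = y" if "y \<in> seqs n" for y
  proof -
    have "y n = 0" using that by (simp add: seqs_def)
    then show ?thesis by (simp add: fun_eq_iff)
  qed
  then have "y - fscale (y n) x \<in> W \<longleftrightarrow> y \<in> W" if "y \<in> seqs n" for y
    using that by (simp only:)
  then show ?thesis using W(2) unfolding adjoin_def by blast
qed

lemma adjoin_not_subset: "\<not> adjoin n x W \<subseteq> seqs n"
  using adjoin_tops tops_empty by blast

lemma dim_adjoin: "F.dim (adjoin n x W) = Suc (F.dim W)"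
  using dim_top[OF subspace_adjoin adjoin_subset adjoin_not_subset] by (simp add: adjoin_Int)

end

lemma card_seqs_tops: "card (tops n (seqs (Suc n)) :: (nat \<Rightarrow> 'k::{field,finite}) set) = CARD('k) ^ n"
proof -
  have "\<not> (seqs (Suc n) :: (nat \<Rightarrow> 'k) set) \<subseteq> seqs n"
  proof
    assume "(seqs (Suc n) :: (nat \<Rightarrow> 'k) set) \<subseteq> seqs n"
    moreover have "(\<lambda>i. if i = n then 1 else 0 :: 'k) \<in> seqs (Suc n)" by (auto simp: seqs_def)
    ultimately have "(\<lambda>i. if i = n then 1 else 0 :: 'k) \<in> seqs n" by (rule subsetD)
    then show False by (auto simp: seqs_def)
  qed
  moreover have "(seqs (Suc n) :: (nat \<Rightarrow> 'k) set) \<inter> seqs n = seqs n"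
    using seqs_mono[of n "Suc n"] by auto
  ultimately have "card (tops n (seqs (Suc n)) :: (nat \<Rightarrow> 'k) set) = CARD('k) ^ F.dim (seqs n :: (nat \<Rightarrow> 'k) set)"
    using card_tops[OF subspace_seqs subset_refl, where ?'k = 'k, of n] by simp
  also have "\<dots> = CARD('k) ^ n"
    by (subst card_seqs[symmetric], subst F.card_subspace[symmetric]) (auto simp: subspace_seqs finite_seqs)
  finally show ?thesis .
qed

text \<open>In the inclusion of the module for \<open>j + 1\<close> into the one for \<open>j + 2\<close>, each space grows by one
  dimension.  A submodule \<open>(U, W)\<close> of the larger module either lies in the smaller one, or leaves it
  at vertex \<open>2\<close> only, or leaves it at vertex \<open>1\<close> and then, since \<open>t U \<subseteq> W\<close>, also at vertex \<open>2\<close>.  The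
  next two definitions are the second and the third case.\<close>

definition subs_gaining_target ::
  "nat \<Rightarrow> int \<Rightarrow> int \<Rightarrow> ((nat \<Rightarrow> 'k::{field,finite}) set \<times> (nat \<Rightarrow> 'k) set) set" where
  "subs_gaining_target j a b = {(U, W) \<in> preprojective_subs (Suc (Suc j)) a b. U \<subseteq> seqs j \<and> \<not> W \<subseteq> seqs (Suc j)}"

definition subs_gaining_both ::
  "nat \<Rightarrow> int \<Rightarrow> int \<Rightarrow> ((nat \<Rightarrow> 'k::{field,finite}) set \<times> (nat \<Rightarrow> 'k) set) set" where
  "subs_gaining_both j a b = {(U, W) \<in> preprojective_subs (Suc (Suc j)) a b. \<not> U \<subseteq> seqs j}"

text \<open>Choosing a monic \<open>x \<in> W\<close> of top degree turns a submodule that leaves the smaller module at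
  vertex \<open>2\<close> only into a submodule of the smaller module together with an arbitrary monic polynomial: adjoining it to \<open>W\<close> preserves all
  conditions.\<close>

lemma bij_subs_gaining_target:
  "bij_betw (\<lambda>((U, W), x). ((U, W \<inter> seqs (Suc j)), x))
     (SIGMA p:subs_gaining_target j a b. tops (Suc j) (snd p))
     ((preprojective_subs (Suc j) a (b - 1) :: ((nat \<Rightarrow> 'k::{field,finite}) set \<times> (nat \<Rightarrow> 'k) set) set)
        \<times> tops (Suc j) (seqs (Suc (Suc j))))"
  (is "bij_betw ?F ?P ?Q")
proof (rule bij_betw_byWitness[where f' = "\<lambda>((U, W), x). ((U, adjoin (Suc j) x W), x)"])
  let ?G = "\<lambda>((U :: (nat \<Rightarrow> 'k) set, W :: (nat \<Rightarrow> 'k) set), x). ((U, adjoin (Suc j) x W), x)"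
  show "\<forall>p\<in>?P. ?G (?F p) = p"
    by (auto simp: subs_gaining_target_def preprojective_subs_def adjoin_restrict)
  show "\<forall>p\<in>?Q. ?F (?G p) = p"
    by (auto simp: preprojective_subs_def tops_def adjoin_Int)
  show "?F ` ?P \<subseteq> ?Q"
  proof (rule image_subsetI)
    fix p assume p: "p \<in> ?P"
    obtain U W :: "(nat \<Rightarrow> 'k) set" and x :: "nat \<Rightarrow> 'k" where eq: "p = ((U, W), x)"
      by (metis surj_pair)
    have "(U, W) \<in> subs_gaining_target j a b" and x: "x \<in> tops (Suc j) (snd (U, W))"
      using p unfolding eq by simp_all
    then have UW: "F.subspace U" "F.subspace W" "U \<subseteq> seqs j" "W \<subseteq> seqs (Suc (Suc j))" "U \<subseteq> W"
      "shift ` U \<subseteq> W" "int (F.dim U) = a" "int (F.dim W) = b" "\<not> W \<subseteq> seqs (Suc j)"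
      by (auto simp: subs_gaining_target_def preprojective_subs_def)
    have "U \<subseteq> seqs (Suc j)" using UW(3) seqs_mono[of j "Suc j"] by auto
    moreover have "shift ` U \<subseteq> seqs (Suc j)" using UW(3) by (auto simp: shift_in_seqs_iff)
    ultimately have "(U, W \<inter> seqs (Suc j)) \<in> preprojective_subs (Suc j) a (b - 1)"
      using UW dim_top[OF UW(2,4,9)] by (auto simp: preprojective_subs_def F.subspace_inter subspace_seqs)
    moreover have "x \<in> tops (Suc j) (seqs (Suc (Suc j)))" using x UW(4) by (auto simp: tops_def)
    ultimately show "?F p \<in> ?Q" by (simp add: eq)
  qed
  show "?G ` ?Q \<subseteq> ?P"
  proof (rule image_subsetI)
    fix p assume p: "p \<in> ?Q"
    obtain U W :: "(nat \<Rightarrow> 'k) set" and x :: "nat \<Rightarrow> 'k" where eq: "p = ((U, W), x)"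
      by (metis surj_pair)
    have "(U, W) \<in> preprojective_subs (Suc j) a (b - 1)"
      and "x \<in> tops (Suc j) (seqs (Suc (Suc j)) :: (nat \<Rightarrow> 'k) set)"
      using p unfolding eq by simp_all
    then have UW: "F.subspace U" "F.subspace W" "U \<subseteq> seqs j" "W \<subseteq> seqs (Suc j)" "U \<subseteq> W"
      "shift ` U \<subseteq> W" "int (F.dim U) = a" "int (F.dim W) = b - 1"
      and x: "x \<in> seqs (Suc (Suc j))" "x (Suc j) = 1"
      by (auto simp: preprojective_subs_def tops_def)
    note adj = UW(2,4) x
    have "W \<subseteq> adjoin (Suc j) x W" using adjoin_Int[OF adj] by blast
    then have "(U, adjoin (Suc j) x W) \<in> subs_gaining_target j a b"
      using UW subspace_adjoin[OF adj] adjoin_subset[OF adj] adjoin_not_subset[OF adj] dim_adjoin[OF adj]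
        seqs_mono[of j "Suc j"]
      by (auto simp: subs_gaining_target_def preprojective_subs_def)
    then show "?G p \<in> ?P" using adjoin_tops[OF adj] by (simp add: eq)
  qed
qed

text \<open>Here the chosen monic polynomial \<open>x\<close> lies in \<open>U\<close>.  Then \<open>t x\<close> must be adjoined to \<open>W\<close>, and \<open>x\<close> itself,
  which belongs to the second space of the smaller module, must be in the smaller \<open>W\<close> already.\<close>

lemma bij_subs_gaining_both:
  "bij_betw (\<lambda>((U, W), x). ((U \<inter> seqs j, W \<inter> seqs (Suc j)), x))
     (SIGMA p:subs_gaining_both j a b. tops j (fst p))
     (SIGMA p:(preprojective_subs (Suc j) (a - 1) (b - 1) ::
        ((nat \<Rightarrow> 'k::{field,finite}) set \<times> (nat \<Rightarrow> 'k) set) set). tops j (snd p))"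
  (is "bij_betw ?F ?P ?Q")
proof (rule bij_betw_byWitness[where f' = "\<lambda>((U, W), x). ((adjoin j x U, adjoin (Suc j) (shift x) W), x)"])
  let ?G = "\<lambda>((U :: (nat \<Rightarrow> 'k) set, W :: (nat \<Rightarrow> 'k) set), x). ((adjoin j x U, adjoin (Suc j) (shift x) W), x)"
  show "\<forall>p\<in>?P. ?G (?F p) = p"
  proof
    fix p assume p: "p \<in> ?P"
    obtain U W :: "(nat \<Rightarrow> 'k) set" and x :: "nat \<Rightarrow> 'k" where eq: "p = ((U, W), x)"
      by (metis surj_pair)
    have "(U, W) \<in> subs_gaining_both j a b" and x: "x \<in> tops j (fst (U, W))"
      using p unfolding eq by simp_all
    then have UW: "F.subspace U" "F.subspace W" "U \<subseteq> seqs (Suc j)" "W \<subseteq> seqs (Suc (Suc j))" "U \<subseteq> W"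
      "shift ` U \<subseteq> W"
      by (auto simp: subs_gaining_both_def preprojective_subs_def)
    have "x \<in> tops j U" "shift x \<in> tops (Suc j) W" using x UW by (auto simp: tops_def)
    then show "?G (?F p) = p" using UW by (simp add: eq adjoin_restrict)
  qed
  show "\<forall>p\<in>?Q. ?F (?G p) = p"
  proof
    fix p assume p: "p \<in> ?Q"
    obtain U W :: "(nat \<Rightarrow> 'k) set" and x :: "nat \<Rightarrow> 'k" where eq: "p = ((U, W), x)"
      by (metis surj_pair)
    have "(U, W) \<in> preprojective_subs (Suc j) (a - 1) (b - 1)" and "x \<in> tops j (snd (U, W))"
      using p unfolding eq by simp_all
    then have "F.subspace U" "F.subspace W" "U \<subseteq> seqs j" "W \<subseteq> seqs (Suc j)"
      and "x \<in> seqs (Suc j)" "x j = 1" "shift x \<in> seqs (Suc (Suc j))" "shift x (Suc j) = 1"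
      by (auto simp: preprojective_subs_def tops_def shift_in_seqs_iff)
    then show "?F (?G p) = p" by (simp add: eq adjoin_Int)
  qed
  show "?F ` ?P \<subseteq> ?Q"
  proof (rule image_subsetI)
    fix p assume p: "p \<in> ?P"
    obtain U W :: "(nat \<Rightarrow> 'k) set" and x :: "nat \<Rightarrow> 'k" where eq: "p = ((U, W), x)"
      by (metis surj_pair)
    have "(U, W) \<in> subs_gaining_both j a b" and x: "x \<in> tops j (fst (U, W))"
      using p unfolding eq by simp_all
    then have UW: "F.subspace U" "F.subspace W" "U \<subseteq> seqs (Suc j)" "W \<subseteq> seqs (Suc (Suc j))" "U \<subseteq> W"
      "shift ` U \<subseteq> W" "int (F.dim U) = a" "int (F.dim W) = b" "\<not> U \<subseteq> seqs j"
      by (auto simp: subs_gaining_both_def preprojective_subs_def)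
    have xx: "x \<in> tops j U" "shift x \<in> tops (Suc j) W" using x UW by (auto simp: tops_def)
    then have nW: "\<not> W \<subseteq> seqs (Suc j)" using tops_empty by blast
    have "seqs j \<subseteq> (seqs (Suc j) :: (nat \<Rightarrow> 'k) set)" by (rule seqs_mono) simp
    then have "(U \<inter> seqs j, W \<inter> seqs (Suc j)) \<in> preprojective_subs (Suc j) (a - 1) (b - 1)"
      using UW dim_top[OF UW(1,3,9)] dim_top[OF UW(2,4) nW]
      by (auto simp: preprojective_subs_def F.subspace_inter subspace_seqs shift_in_seqs_iff)
    moreover have "x \<in> tops j (W \<inter> seqs (Suc j))" using xx UW by (auto simp: tops_def)
    ultimately show "?F p \<in> ?Q" by (simp add: eq)
  qed
  show "?G ` ?Q \<subseteq> ?P"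
  proof (rule image_subsetI)
    fix p assume p: "p \<in> ?Q"
    obtain U W :: "(nat \<Rightarrow> 'k) set" and x :: "nat \<Rightarrow> 'k" where eq: "p = ((U, W), x)"
      by (metis surj_pair)
    have "(U, W) \<in> preprojective_subs (Suc j) (a - 1) (b - 1)" and "x \<in> tops j (snd (U, W))"
      using p unfolding eq by simp_all
    then have UW: "F.subspace U" "F.subspace W" "U \<subseteq> seqs j" "W \<subseteq> seqs (Suc j)" "U \<subseteq> W"
      "shift ` U \<subseteq> W" "int (F.dim U) = a - 1" "int (F.dim W) = b - 1"
      and xW: "x \<in> W" and x: "x \<in> seqs (Suc j)" "x j = 1"
      and sx: "shift x \<in> seqs (Suc (Suc j))" "shift x (Suc j) = 1"
      by (auto simp: preprojective_subs_def tops_def shift_in_seqs_iff)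
    note adU = UW(1,3) x and adW = UW(2,4) sx
    have WW: "W \<subseteq> adjoin (Suc j) (shift x) W" using adjoin_Int[OF adW] by blast
    have "y \<in> W" if "y \<in> adjoin j x U" for y
    proof -
      have "y - fscale (y j) x \<in> W" using that UW by (auto simp: adjoin_def)
      then have "(y - fscale (y j) x) + fscale (y j) x \<in> W"
        using xW UW(2) by (intro F.subspace_add F.subspace_scale)
      then show ?thesis by simp
    qed
    moreover have "shift y \<in> adjoin (Suc j) (shift x) W" if "y \<in> adjoin j x U" for y
    proof -
      have "shift y - fscale (shift y (Suc j)) (shift x) = shift (y - fscale (y j) x)"
        by (auto simp: fun_eq_iff shift_def split: nat.splits)
      then show ?thesis using that UW(6) by (auto simp: adjoin_def)
    qed
    ultimately have "(adjoin j x U, adjoin (Suc j) (shift x) W) \<in> subs_gaining_both j a b"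
      using UW WW subspace_adjoin[OF adU] adjoin_subset[OF adU] adjoin_not_subset[OF adU] dim_adjoin[OF adU]
        subspace_adjoin[OF adW] adjoin_subset[OF adW] dim_adjoin[OF adW]
      by (auto simp: subs_gaining_both_def preprojective_subs_def)
    then show "?G p \<in> ?P" using adjoin_tops[OF adU] by (simp add: eq)
  qed
qed


section \<open>The recurrence for the number of submodules\<close>

lemma qhalf_double: "qhalf (2 * int n) = (of_nat (CARD('k) ^ n) :: 'k::finite coeff)"
proof -
  have rep: "Rep_coeff (of_nat m :: 'k coeff) = real m" for m
    by (induction m) (auto simp: zero_coeff.rep_eq one_coeff.rep_eq plus_coeff.rep_eq)
  have "Rep_coeff (qhalf 2 :: 'k coeff) = Rep_coeff (of_nat CARD('k) :: 'k coeff)"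
    by (simp add: qhalf.rep_eq rep power_int_def)
  then have 2: "qhalf 2 = (of_nat CARD('k) :: 'k coeff)" by (simp only: Rep_coeff_inject)
  show ?thesis
  proof (induction n)
    case (Suc n)
    have "qhalf (2 * int (Suc n)) = qhalf 2 * (qhalf (2 * int n) :: 'k coeff)"
      by (simp add: qhalf_add[symmetric] algebra_simps)
    then show ?case using Suc 2 by simp
  qed simp
qed

definition count_subs :: "nat \<Rightarrow> int \<Rightarrow> int \<Rightarrow> ('k::{field,finite}) coeff" where
  "count_subs j a b = of_nat (card (preprojective_subs j a b :: ((nat \<Rightarrow> 'k) set \<times> (nat \<Rightarrow> 'k) set) set))"

text \<open>A subspace of dimension \<open>d\<close> that contains a monic polynomial of degree \<open>n\<close> contains \<open>q\<^sup>d\<^sup>-\<^sup>1\<close> of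
  them.\<close>

lemma card_Sigma_tops:
  fixes A :: "((nat \<Rightarrow> 'k::{field,finite}) set \<times> (nat \<Rightarrow> 'k) set) set" and \<pi> :: "_ \<Rightarrow> (nat \<Rightarrow> 'k) set"
  assumes fin: "finite A" and sub: "\<And>p. p \<in> A \<Longrightarrow> F.subspace (\<pi> p) \<and> \<pi> p \<subseteq> seqs (Suc n) \<and> int (F.dim (\<pi> p)) = d"
  shows "of_nat (card (SIGMA p:A. tops n (\<pi> p))) =
    (of_nat (card {p \<in> A. \<not> \<pi> p \<subseteq> seqs n}) * qhalf (2 * (d - 1)) :: 'k coeff)"
proof -
  have finp: "finite (tops n (\<pi> p))" if "p \<in> A" for p
    using finite_subspace_of_seqs[of "\<pi> p" n] sub[OF that] by (simp add: tops_def)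
  have "(of_nat (card (SIGMA p:A. tops n (\<pi> p))) :: 'k coeff) = (\<Sum>p\<in>A. of_nat (card (tops n (\<pi> p))))"
    using fin finp by (simp add: card_SigmaI)
  also have "\<dots> = (\<Sum>p\<in>A. if \<not> \<pi> p \<subseteq> seqs n then qhalf (2 * (d - 1)) else 0)"
  proof (rule sum.cong[OF refl])
    fix p assume p: "p \<in> A"
    show "of_nat (card (tops n (\<pi> p))) = (if \<not> \<pi> p \<subseteq> seqs n then qhalf (2 * (d - 1)) else (0 :: 'k coeff))"
    proof (cases "\<pi> p \<subseteq> seqs n")
      case True
      then show ?thesis by (simp add: tops_empty)
    next
      case False
      have "d - 1 = int (F.dim (\<pi> p \<inter> seqs n))" "card (tops n (\<pi> p)) = CARD('k) ^ F.dim (\<pi> p \<inter> seqs n)"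
        using sub[OF p] dim_top[of "\<pi> p" n] card_tops[of "\<pi> p" n] False by auto
      then show ?thesis using False by (simp only: qhalf_double) simp
    qed
  qed
  also have "\<dots> = of_nat (card {p \<in> A. \<not> \<pi> p \<subseteq> seqs n}) * qhalf (2 * (d - 1))"
    using fin by (simp add: sum.If_cases Int_def)
  finally show ?thesis .
qed

lemma qhalf_solve:
  assumes "x * qhalf m = y * (qhalf n :: ('k::finite) coeff)" and "n - m = d"
  shows "x = qhalf d * y"
proof -
  have "x = x * qhalf m * qhalf (- m)" by (simp add: mult.assoc qhalf_add[symmetric])
  also have "\<dots> = y * (qhalf n * qhalf (- m))" using assms(1) by (simp add: mult.assoc)
  also have "qhalf n * qhalf (- m) = (qhalf d :: 'k coeff)" using assms(2) by (simp add: qhalf_add[symmetric])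
  finally show ?thesis by (simp add: mult.commute)
qed

lemma card_subs_gaining_target:
  "(of_nat (card (subs_gaining_target j a b :: ((nat \<Rightarrow> 'k::{field,finite}) set \<times> (nat \<Rightarrow> 'k) set) set)) :: 'k coeff) =
     qhalf (2 * (int j + 2 - b)) * count_subs (Suc j) a (b - 1)"
proof -
  let ?A = "subs_gaining_target j a b :: ((nat \<Rightarrow> 'k) set \<times> (nat \<Rightarrow> 'k) set) set"
  have fin: "finite ?A"
    by (rule finite_subset[OF _ finite_preprojective_subs]) (auto simp: subs_gaining_target_def)
  have A: "{p \<in> ?A. \<not> snd p \<subseteq> seqs (Suc j)} = ?A"
    by (auto simp: subs_gaining_target_def)
  have "(of_nat (card ?A) * qhalf (2 * (b - 1)) :: 'k coeff) =
      of_nat (card (SIGMA p:?A. tops (Suc j) (snd p)))"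
    using card_Sigma_tops[OF fin, where \<pi> = snd and n = "Suc j" and d = b] unfolding A
    by (auto simp: subs_gaining_target_def preprojective_subs_def)
  also have "\<dots> = count_subs (Suc j) a (b - 1) * qhalf (2 * int (Suc j))"
    using bij_betw_same_card[OF bij_subs_gaining_target[of j a b, where 'k = 'k]]
    by (simp add: card_cartesian_product card_seqs_tops count_subs_def qhalf_double del: of_nat_Suc power_Suc)
  finally show ?thesis by (rule qhalf_solve) simp
qed

text \<open>The smaller \<open>W\<close> has to contain a monic polynomial of degree \<open>j\<close>.  The submodules for which it
  does not are those of the next smaller module; they cause the negative term.\<close>

lemma card_subs_gaining_both:
  "(of_nat (card (subs_gaining_both j a b :: ((nat \<Rightarrow> 'k::{field,finite}) set \<times> (nat \<Rightarrow> 'k) set) set)) :: 'k coeff) =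
     qhalf (2 * (b - a - 1)) * (count_subs (Suc j) (a - 1) (b - 1) - count_subs j (a - 1) (b - 1))"
proof -
  let ?A = "subs_gaining_both j a b :: ((nat \<Rightarrow> 'k) set \<times> (nat \<Rightarrow> 'k) set) set"
    and ?B = "preprojective_subs (Suc j) (a - 1) (b - 1) :: ((nat \<Rightarrow> 'k) set \<times> (nat \<Rightarrow> 'k) set) set"
    and ?C = "preprojective_subs j (a - 1) (b - 1) :: ((nat \<Rightarrow> 'k) set \<times> (nat \<Rightarrow> 'k) set) set"
  have fin: "finite ?A"
    by (rule finite_subset[OF _ finite_preprojective_subs]) (auto simp: subs_gaining_both_def)
  have A: "{p \<in> ?A. \<not> fst p \<subseteq> seqs j} = ?A"
    by (auto simp: subs_gaining_both_def)
  have CB: "?C \<subseteq> ?B" "{p \<in> ?B. \<not> snd p \<subseteq> seqs j} = ?B - ?C"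
    unfolding preprojective_subs_restrict[of j "a - 1" "b - 1", symmetric] by auto
  have "(of_nat (card ?A) * qhalf (2 * (a - 1)) :: 'k coeff) = of_nat (card (SIGMA p:?A. tops j (fst p)))"
    using card_Sigma_tops[OF fin, where \<pi> = fst and n = j and d = a] unfolding A
    by (auto simp: subs_gaining_both_def preprojective_subs_def)
  also have "\<dots> = of_nat (card (SIGMA p:?B. tops j (snd p)))"
    using bij_betw_same_card[OF bij_subs_gaining_both[of j a b, where 'k = 'k]] by simp
  also have "\<dots> = of_nat (card (?B - ?C)) * qhalf (2 * (b - 1 - 1))"
    unfolding CB(2)[symmetric]
    by (rule card_Sigma_tops[OF finite_preprojective_subs]) (auto simp: preprojective_subs_def)
  also have "(of_nat (card (?B - ?C)) :: 'k coeff) = count_subs (Suc j) (a - 1) (b - 1) - count_subs j (a - 1) (b - 1)"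
  proof -
    have "?B \<inter> ?C = ?C" using CB(1) by blast
    then have "card ?B = card ?C + card (?B - ?C)"
      using card_Int_Diff[OF finite_preprojective_subs, of "Suc j" "a - 1" "b - 1" ?C] by simp
    then show ?thesis by (simp add: count_subs_def)
  qed
  finally show ?thesis by (rule qhalf_solve) simp
qed

text \<open>The three summands belong to the three kinds of submodules: those of the smaller module, those
  leaving it at vertex \<open>2\<close> only, and those leaving it at both vertices.\<close>

theorem count_subs_rec:
  "count_subs (Suc (Suc j)) a b = (count_subs (Suc j) a b
     + qhalf (2 * (int j + 2 - b)) * count_subs (Suc j) a (b - 1)
     + qhalf (2 * (b - a - 1)) * (count_subs (Suc j) (a - 1) (b - 1) - count_subs j (a - 1) (b - 1))
     :: ('k::{field,finite}) coeff)"
proof -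
  let ?A = "preprojective_subs (Suc (Suc j)) a b :: ((nat \<Rightarrow> 'k) set \<times> (nat \<Rightarrow> 'k) set) set"
    and ?B = "preprojective_subs (Suc j) a b :: ((nat \<Rightarrow> 'k) set \<times> (nat \<Rightarrow> 'k) set) set"
    and ?N1 = "subs_gaining_both j a b :: ((nat \<Rightarrow> 'k) set \<times> (nat \<Rightarrow> 'k) set) set"
    and ?N2 = "subs_gaining_target j a b :: ((nat \<Rightarrow> 'k) set \<times> (nat \<Rightarrow> 'k) set) set"
  have B: "?B = {(U, W) \<in> ?A. W \<subseteq> seqs (Suc j)}" by (rule preprojective_subs_restrict[symmetric])
  have BU: "U \<subseteq> seqs j" if "(U, W) \<in> ?B" for U W using that by (simp add: preprojective_subs_def)
  have "?A = ?B \<union> ?N2 \<union> ?N1" unfolding B subs_gaining_both_def subs_gaining_target_def by auto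
  moreover have "?B \<inter> ?N2 = {}" unfolding B subs_gaining_target_def by auto
  moreover have "(?B \<union> ?N2) \<inter> ?N1 = {}" using BU unfolding subs_gaining_both_def subs_gaining_target_def by auto
  moreover have "finite ?A" "finite ?B" by (rule finite_preprojective_subs)+
  ultimately have "card ?A = card ?B + card ?N2 + card ?N1"
    by (simp add: card_Un_disjoint)
  then have "(of_nat (card ?A) :: 'k coeff) = of_nat (card ?B) + of_nat (card ?N2) + of_nat (card ?N1)"
    by simp
  then show ?thesis by (simp only: card_subs_gaining_both card_subs_gaining_target count_subs_def[symmetric])
qed

lemma dim_le_seqs:
  fixes U :: "(nat \<Rightarrow> 'k::{field,finite}) set"
  assumes "F.subspace U" "U \<subseteq> seqs n"
  shows "F.dim U \<le> n"
proof -
  have "finite U" using assms(2) finite_seqs by (rule finite_subset)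
  then have "CARD('k) ^ F.dim U \<le> CARD('k) ^ n"
    using assms card_mono[OF finite_seqs assms(2)] by (simp add: F.card_subspace card_seqs)
  then show ?thesis using F.card_field_gt_1[where 'k = 'k] by simp
qed

lemma count_subs_outside:
  assumes "\<not> (0 \<le> a \<and> a \<le> int l \<and> 0 \<le> b \<and> b \<le> int l + 1)"
  shows "count_subs (Suc l) a b = (0 :: ('k::{field,finite}) coeff)"
proof -
  have "preprojective_subs (Suc l) a b = ({} :: ((nat \<Rightarrow> 'k) set \<times> (nat \<Rightarrow> 'k) set) set)"
  proof (rule equals0I)
    fix p assume "p \<in> (preprojective_subs (Suc l) a b :: ((nat \<Rightarrow> 'k) set \<times> (nat \<Rightarrow> 'k) set) set)"
    then obtain U W :: "(nat \<Rightarrow> 'k) set" where UW: "F.subspace U" "F.subspace W" "U \<subseteq> seqs l"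
      "W \<subseteq> seqs (Suc l)" "int (F.dim U) = a" "int (F.dim W) = b"
      by (auto simp: preprojective_subs_def)
    then show False using dim_le_seqs[OF UW(1,3)] dim_le_seqs[OF UW(2,4)] assms by auto
  qed
  then show ?thesis by (simp add: count_subs_def)
qed

lemma subspace_dim_0: "F.subspace U \<Longrightarrow> finite U \<Longrightarrow> F.dim U = 0 \<longleftrightarrow> U = {0}"
  using F.dim_eq_iff_card[of U 0] F.subspace_0[of U] by (auto simp: card_1_singleton_iff)

lemma count_subs_0: "count_subs 0 a b = (if a = 0 \<and> b = 0 then 1 else (0 :: ('k::{field,finite}) coeff))"
proof -
  have "preprojective_subs 0 a b = (if a = 0 \<and> b = 0 then {({0}, {0})} else ({} :: ((nat \<Rightarrow> 'k) set \<times> (nat \<Rightarrow> 'k) set) set))"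
  proof -
    have "U \<subseteq> {0} \<longleftrightarrow> U = {0}" if "F.subspace U" for U :: "(nat \<Rightarrow> 'k) set"
      using F.subspace_0[OF that] by auto
    moreover have "F.dim ({0} :: (nat \<Rightarrow> 'k) set) = 0" using subspace_dim_0[of "{0}"] by simp
    moreover have "shift 0 = (0 :: nat \<Rightarrow> 'k)" by (auto simp: shift_def fun_eq_iff split: nat.splits)
    ultimately show ?thesis by (auto simp: preprojective_subs_def)
  qed
  then show ?thesis by (simp add: count_subs_def)
qed

lemma count_subs_1:
  "count_subs (Suc 0) a b = (if a = 0 \<and> (b = 0 \<or> b = 1) then 1 else (0 :: ('k::{field,finite}) coeff))"
proof -
  have fin: "finite W" if "W \<subseteq> seqs (Suc 0)" for W :: "(nat \<Rightarrow> 'k) set"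
    using that finite_seqs by (rule finite_subset)
  have 0: "F.dim ({0} :: (nat \<Rightarrow> 'k) set) = 0" using subspace_dim_0[of "{0}"] by simp
  have s0: "shift 0 = (0 :: nat \<Rightarrow> 'k)" by (auto simp: shift_def fun_eq_iff split: nat.splits)
  have mem: "(U, W) \<in> preprojective_subs (Suc 0) 0 d \<longleftrightarrow>
      U = {0} \<and> F.subspace W \<and> W \<subseteq> seqs (Suc 0) \<and> int (F.dim W) = d" for U W :: "(nat \<Rightarrow> 'k) set" and d
  proof
    assume "(U, W) \<in> preprojective_subs (Suc 0) 0 d"
    then have "F.subspace U" "U \<subseteq> {0}" "F.subspace W \<and> W \<subseteq> seqs (Suc 0) \<and> int (F.dim W) = d"
      by (auto simp: preprojective_subs_def)
    then show "U = {0} \<and> F.subspace W \<and> W \<subseteq> seqs (Suc 0) \<and> int (F.dim W) = d"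
      using F.subspace_0[of U] by blast
  next
    assume "U = {0} \<and> F.subspace W \<and> W \<subseteq> seqs (Suc 0) \<and> int (F.dim W) = d"
    then show "(U, W) \<in> preprojective_subs (Suc 0) 0 d"
      using F.subspace_0[of W] by (simp add: preprojective_subs_def s0 0)
  qed
  have "F.subspace W \<and> W \<subseteq> seqs (Suc 0) \<and> int (F.dim W) = 0 \<longleftrightarrow> W = {0}" for W :: "(nat \<Rightarrow> 'k) set"
    using subspace_dim_0[of W] fin[of W] 0 F.subspace_0[OF subspace_seqs[of "Suc 0"]] by auto
  then have "preprojective_subs (Suc 0) 0 0 = {({0}, {0} :: (nat \<Rightarrow> 'k) set)}"
    by (simp add: set_eq_iff split_paired_all mem)
  then have c0: "count_subs (Suc 0) 0 0 = (1 :: 'k coeff)" by (simp add: count_subs_def)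
  have full: "F.dim W = Suc 0 \<longleftrightarrow> W = seqs (Suc 0)" if "F.subspace W" "W \<subseteq> seqs (Suc 0)" for W :: "(nat \<Rightarrow> 'k) set"
  proof -
    have "F.dim W = Suc 0 \<longleftrightarrow> card W = card (seqs (Suc 0) :: (nat \<Rightarrow> 'k) set)"
      using F.dim_eq_iff_card[OF that(1) fin[OF that(2)], of "Suc 0"] by (simp add: card_seqs)
    also have "\<dots> \<longleftrightarrow> W = seqs (Suc 0)" using that card_subset_eq[OF finite_seqs that(2)] by auto
    finally show ?thesis .
  qed
  have "F.subspace W \<and> W \<subseteq> seqs (Suc 0) \<and> int (F.dim W) = 1 \<longleftrightarrow> W = seqs (Suc 0)" for W :: "(nat \<Rightarrow> 'k) set"
    using full[of W] full[OF subspace_seqs subset_refl] subspace_seqs[of "Suc 0"] by auto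
  then have "preprojective_subs (Suc 0) 0 1 = {({0}, seqs (Suc 0) :: (nat \<Rightarrow> 'k) set)}"
    by (simp add: set_eq_iff split_paired_all mem)
  then have c1: "count_subs (Suc 0) 0 1 = (1 :: 'k coeff)" by (simp add: count_subs_def)
  show ?thesis
  proof (cases "0 \<le> a \<and> a \<le> int 0 \<and> 0 \<le> b \<and> b \<le> int 0 + 1")
    case True
    then have "a = 0" "b = 0 \<or> b = 1" by auto
    then show ?thesis using c0 c1 by auto
  next
    case False
    then show ?thesis using count_subs_outside[OF False] by auto
  qed
qed


section \<open>Coefficients of cluster characters\<close>

text \<open>The double dual is isomorphic to \<open>M\<close>, but lives in \<open>nat \<Rightarrow> 'k\<close>, where the structure theorem
  applies.\<close>

lemma card_Gr_preprojective:
  fixes scale :: "'k::{field,finite} \<Rightarrow> 'v::ab_group_add \<Rightarrow> 'v"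
  assumes "vector_space scale" and ind: "indecomposable scale M"
    and dv: "dim_vector scale M = (l, l + 1)" and e: "e1 \<le> l" "e2 \<le> l + 1"
  shows "(of_nat (card (Gr scale (e1, e2) M)) :: 'k coeff) = count_subs (Suc l) (int e1) (int e2)"
proof -
  interpret finite_field_space scale using assms(1) by (simp add: finite_field_space_def)
  have "kronecker_module scale M" using ind by (simp add: indecomposable_def)
  then obtain N p1 p2 where "dual_modules scale fscale M N p1 p2" by (rule dual_module_exists)
  then interpret d: dual_modules scale fscale M N p1 p2 .
  obtain N' p1' p2' where "dual_modules fscale fscale N N' p1' p2'"
    using d.mod(2) by (rule F.dual_module_exists)
  then interpret d': dual_modules fscale fscale N N' p1' p2' .
  have dN: "dim_vector fscale N = (l + 1, l)" using d.dim_vector_dual dv by simp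
  have dN': "dim_vector fscale N' = (l, Suc l)" using d'.dim_vector_dual dN by simp
  have "indecomposable fscale N'" by (intro d'.indecomposable_dual d.indecomposable_dual ind)
  then obtain \<theta>1 \<theta>2 where iso: "kronecker_iso (preprojective l) N' \<theta>1 \<theta>2"
    using indecomposable_preprojective[OF _ dN'] by blast
  have "card (Gr scale (e1, e2) M) = card (Gr fscale (l + 1 - e2, l - e1) N)"
    using d.card_Gr_dual[OF dv e] by simp
  also have "\<dots> = card (Gr fscale (l - (l - e1), l + 1 - (l + 1 - e2)) N')"
    using d'.card_Gr_dual[OF dN, of "l + 1 - e2" "l - e1"] by simp
  also have "\<dots> = card (Gr fscale (e1, e2) N')" using e by simp
  also have "\<dots> = card (Gr fscale (e1, e2) (preprojective l :: (nat \<Rightarrow> 'k) kronecker))"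
    by (rule card_Gr_iso[OF kronecker_module_preprojective iso, symmetric])
  finally show ?thesis by (simp add: Gr_preprojective count_subs_def)
qed

lemma card_Gr_preinjective:
  fixes scale :: "'k::{field,finite} \<Rightarrow> 'v::ab_group_add \<Rightarrow> 'v"
  assumes "vector_space scale" and ind: "indecomposable scale M"
    and dv: "dim_vector scale M = (l + 1, l)" and e: "e1 \<le> l + 1" "e2 \<le> l"
  shows "(of_nat (card (Gr scale (e1, e2) M)) :: 'k coeff) =
    count_subs (Suc l) (int l - int e2) (int l + 1 - int e1)"
proof -
  interpret finite_field_space scale using assms(1) by (simp add: finite_field_space_def)
  have "kronecker_module scale M" using ind by (simp add: indecomposable_def)
  then obtain N p1 p2 where "dual_modules scale fscale M N p1 p2" by (rule dual_module_exists)
  then interpret d: dual_modules scale fscale M N p1 p2 .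
  have dN: "dim_vector fscale N = (l, l + 1)" using d.dim_vector_dual dv by simp
  have "card (Gr scale (e1, e2) M) = card (Gr fscale (l - e2, l + 1 - e1) N)"
    using d.card_Gr_dual[OF dv e] by simp
  moreover have "(of_nat (card (Gr fscale (l - e2, l + 1 - e1) N)) :: 'k coeff) =
      count_subs (Suc l) (int (l - e2)) (int (l + 1 - e1))"
    by (rule card_Gr_preprojective) (auto simp: dN F.vector_space_axioms d.indecomposable_dual ind)
  ultimately show ?thesis using e by (simp add: of_nat_diff algebra_simps)
qed

lift_definition tcoeff :: "('k::finite) qtorus \<Rightarrow> expo \<Rightarrow> 'k coeff" is Poly_Mapping.lookup .

lemma tcoeff_eqI: "(\<And>b. tcoeff x b = tcoeff y b) \<Longrightarrow> x = y"
  by transfer (rule poly_mapping_eqI)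

lemma tcoeff_0 [simp]: "tcoeff 0 b = 0"
  by transfer simp

lemma tcoeff_add [simp]: "tcoeff (x + y) b = tcoeff x b + tcoeff y b"
  by transfer (rule lookup_add)

lemma tcoeff_X: "tcoeff (X e) b = (if e = b then 1 else 0)"
  by transfer (simp add: lookup_single when_def)

lemma tcoeff_scl [simp]: "tcoeff (c \<cdot> x) b = c * tcoeff x b"
  by transfer (rule lookup_coeff_scale)

lemma tcoeff_sum: "tcoeff (sum f A) b = (\<Sum>a\<in>A. tcoeff (f a) b)"
  by (induction A rule: infinite_finite_induct) auto

lemma tcoeff_X_mult: "tcoeff (X e * x) b = tcoeff x (b - e) * qhalf (Lam e (b - e))"
proof (transfer, goal_cases)
  case (1 e x b)
  show ?case
    by (induction x rule: poly_mapping_additive_induct)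
       (auto simp: twisted_mult_zero twisted_mult_add_right twisted_mult_single lookup_add lookup_single when_def algebra_simps)
qed

lemma tcoeff_mult_X: "tcoeff (x * X e) b = tcoeff x (b - e) * qhalf (Lam (b - e) e)"
proof (transfer, goal_cases)
  case (1 x e b)
  show ?case
    by (induction x rule: poly_mapping_additive_induct)
       (auto simp: twisted_mult_zero twisted_mult_add_left twisted_mult_single lookup_add lookup_single when_def algebra_simps)
qed

lemma one_scl: "1 \<cdot> x = x"
  by (rule tcoeff_eqI) simp

text \<open>The last two entries of the exponent of \<open>X\<close> determine the submodule dimension, so each coefficient
  of the cluster character receives at most one summand.  The vanishing of \<open>N\<close> outside the range of
  summation removes all conditions on the range from the formula.\<close>

lemma tcoeff_cluster_char:
  fixes scale :: "'k::{field,finite} \<Rightarrow> 'v::ab_group_add \<Rightarrow> 'v"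
  assumes dv: "dim_vector scale M = (m1, m2)"
    and N: "\<And>e1 e2. e1 \<le> m1 \<Longrightarrow> e2 \<le> m2 \<Longrightarrow> of_nat (card (Gr scale (e1, e2) M)) = (N (int e1) (int e2) :: 'k coeff)"
    and out: "\<And>a b. \<not> (0 \<le> a \<and> a \<le> int m1 \<and> 0 \<le> b \<and> b \<le> int m2) \<Longrightarrow> N a b = 0"
  shows "tcoeff (cluster_char scale M) (b1, b2, b3, b4) =
    (if b1 = 2 * b4 - int m1 \<and> b2 = 2 * int m1 - 2 * b3 - int m2
     then N (int m1 - b3) (int m2 - b4) * qhalf (- euler_form (int m1 - b3, int m2 - b4) (b3, b4)) else 0)"
proof -
  let ?E = "\<lambda>e1 e2. (2 * int m2 - int m1 - 2 * int e2, 2 * int e1 - int m2, int m1 - int e1, int m2 - int e2)"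
  let ?c = "\<lambda>e1 e2. N (int e1) (int e2) * qhalf (- euler_form (int e1, int e2) (int m1 - int e1, int m2 - int e2))"
  let ?C = "b1 = 2 * b4 - int m1 \<and> b2 = 2 * int m1 - 2 * b3 - int m2"
  have "tcoeff (cluster_char scale M) (b1, b2, b3, b4) =
      (\<Sum>(e1, e2)\<in>{0..m1} \<times> {0..m2}. ?c e1 e2 * (if ?E e1 e2 = (b1, b2, b3, b4) then 1 else 0))"
    unfolding cluster_char_def dv prod.case tcoeff_sum
    by (rule sum.cong[OF refl]) (auto simp: tcoeff_X N simp del: euler_form.simps)
  also have "\<dots> = (\<Sum>p\<in>{0..m1} \<times> {0..m2}. if ?C \<and> int (fst p) = int m1 - b3 \<and> int (snd p) = int m2 - b4
      then N (int m1 - b3) (int m2 - b4) * qhalf (- euler_form (int m1 - b3, int m2 - b4) (b3, b4)) else 0)"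
    by (rule sum.cong[OF refl]) (auto simp: split_paired_all algebra_simps simp del: euler_form.simps)
  also have "\<dots> = (if ?C then N (int m1 - b3) (int m2 - b4) * qhalf (- euler_form (int m1 - b3, int m2 - b4) (b3, b4)) else 0)"
  proof (cases "?C \<and> 0 \<le> int m1 - b3 \<and> int m1 - b3 \<le> int m1 \<and> 0 \<le> int m2 - b4 \<and> int m2 - b4 \<le> int m2")
    case True
    define p0 where "p0 = (nat (int m1 - b3), nat (int m2 - b4))"
    have "p0 \<in> {0..m1} \<times> {0..m2}" using True by (auto simp: p0_def)
    moreover have "int (fst p) = int m1 - b3 \<and> int (snd p) = int m2 - b4 \<longleftrightarrow> p = p0" for p
      using True by (cases p) (auto simp: p0_def)
    ultimately show ?thesis using True by (simp del: euler_form.simps)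
  next
    case False
    then show ?thesis using out[of "int m1 - b3" "int m2 - b4"]
      by (auto intro!: sum.neutral simp del: euler_form.simps)
  qed
  finally show ?thesis .
qed

text \<open>The coefficients of the cluster character of the preprojective module of dimension vector
  \<open>(j - 1, j)\<close>, in terms of the exponent.  For \<open>j = 0\<close> they are those of the monomial
  \<open>X (1, 0, -1, 0)\<close>, as if there were a module of dimension vector \<open>(-1, 0)\<close>.\<close>

definition preprojective_coeff :: "nat \<Rightarrow> expo \<Rightarrow> ('k::{field,finite}) coeff" where
  "preprojective_coeff j b = (case b of (b1, b2, b3, b4) \<Rightarrow>
     if b1 = 2 * b4 + 1 - int j \<and> b2 = int j - 2 - 2 * b3
     then count_subs j (int j - 1 - b3) (int j - b4) * qhalf (- euler_form (int j - 1 - b3, int j - b4) (b3, b4))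
     else 0)"

text \<open>The same for the preinjective module of dimension vector \<open>(j, j - 1)\<close>, expressed through the
  submodules of its dual.  For \<open>j = 0\<close> the monomial is \<open>X (0, 1, 0, 0)\<close>, the cluster variable \<open>x\<^sub>2\<close>.\<close>

definition preinjective_coeff :: "nat \<Rightarrow> expo \<Rightarrow> ('k::{field,finite}) coeff" where
  "preinjective_coeff j b = (case b of (b1, b2, b3, b4) \<Rightarrow>
     if b1 = 2 * b4 - int j \<and> b2 = int j + 1 - 2 * b3
     then count_subs j b4 b3 * qhalf (- euler_form (b4, b3) (int j - 1 - b4, int j - b3))
     else 0)"

text \<open>Rewrite rules that gather the powers of \<open>q\<close> in each summand into one, after which the two sides of
  a recurrence can be compared exponent by exponent.\<close>

lemma qhalf_collect:
  "x * qhalf a * qhalf b = x * qhalf (a + b)"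
  "qhalf a * x * qhalf b = x * qhalf (a + b)"
  "(x + y) * qhalf b = x * qhalf b + y * qhalf b"
  "(x - y) * qhalf b = x * qhalf b - y * qhalf b"
  "qhalf a * (x - y) = qhalf a * x - qhalf a * y"
  by (simp_all add: qhalf_add algebra_simps)

text \<open>At the exponent that belongs to the dimension vector \<open>(e1, e2)\<close> for \<open>j + 2\<close>, the three monomials of
  \<open>X_delta\<close> select the coefficients of \<open>P (j + 1)\<close> at \<open>(e1, e2)\<close>, \<open>(e1, e2 - 1)\<close> and \<open>(e1 - 1, e2 - 1)\<close>,
  and \<open>X (0, 0, 1, 1)\<close> selects the one of \<open>P j\<close> at \<open>(e1 - 1, e2 - 1)\<close>.  These are the terms of
  \<open>count_subs_rec\<close>, and the commutation factors of the quantum torus are its powers of \<open>q\<close>.\<close>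

lemma preprojective_recurrence:
  fixes P :: "nat \<Rightarrow> ('k::{field,finite}) qtorus"
  assumes P: "\<And>j b. tcoeff (P j) b = preprojective_coeff j b"
  shows "X_delta * P (Suc j) = P (Suc (Suc j)) + X (0, 0, 1, 1) * P j"
proof (rule tcoeff_eqI)
  fix b :: expo
  obtain b1 b2 b3 b4 where b: "b = (b1, b2, b3, b4)" by (metis surj_pair)
  define e1 e2 where "e1 = int j + 1 - b3" and "e2 = int j + 2 - b4"
  have b34: "b3 = int j + 1 - e1" "b4 = int j + 2 - e2" by (simp_all add: e1_def e2_def)
  show "tcoeff (X_delta * P (Suc j)) b = tcoeff (P (Suc (Suc j)) + X (0, 0, 1, 1) * P j) b"
  proof (cases "b1 = 2 * b4 - int j - 1 \<and> b2 = int j - 2 * b3")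
    case True
    then have b12: "b1 = int j + 3 - 2 * e2" "b2 = 2 * e1 - int j - 2" by (auto simp: b34)
    show ?thesis
      unfolding b b12 b34
      by (simp add: X_delta_def distrib_right tcoeff_X_mult P preprojective_coeff_def
           count_subs_rec[of j e1 e2] qhalf_collect)
         (simp add: algebra_simps)
  next
    case False
    then show ?thesis
      unfolding b
      by (auto simp: X_delta_def distrib_right tcoeff_X_mult P preprojective_coeff_def)
  qed
qed

text \<open>The mirror image: with \<open>X_delta\<close> on the right, the same four submodule counts appear, with the roles
  of the first and the third monomial of \<open>X_delta\<close> exchanged.\<close>

lemma preinjective_recurrence:
  fixes R :: "nat \<Rightarrow> ('k::{field,finite}) qtorus"
  assumes R: "\<And>j b. tcoeff (R j) b = preinjective_coeff j b"
  shows "R (Suc j) * X_delta = R (Suc (Suc j)) + R j * X (0, 0, 1, 1)"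
proof (rule tcoeff_eqI)
  fix b :: expo
  obtain b1 b2 e2 e1 where b: "b = (b1, b2, e2, e1)" by (metis surj_pair)
  show "tcoeff (R (Suc j) * X_delta) b = tcoeff (R (Suc (Suc j)) + R j * X (0, 0, 1, 1)) b"
  proof (cases "b1 = 2 * e1 - int j - 2 \<and> b2 = int j + 3 - 2 * e2")
    case True
    then have b12: "b1 = 2 * e1 - int j - 2" "b2 = int j + 3 - 2 * e2" by auto
    show ?thesis
      unfolding b b12
      by (simp add: X_delta_def distrib_left tcoeff_mult_X R preinjective_coeff_def
           count_subs_rec[of j e1 e2] qhalf_collect)
         (simp add: algebra_simps)
  next
    case False
    then show ?thesis
      unfolding b
      by (auto simp: X_delta_def distrib_left tcoeff_mult_X R preinjective_coeff_def)
  qed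
qed


section \<open>Chebyshev recurrences\<close>

lemma chebyshev_commute:
  fixes s :: "nat \<Rightarrow> 'r::ring_1"
  assumes s: "s 0 = 1" "\<And>n. s (Suc (Suc n)) = s (Suc n) * s (Suc 0) - z * s n"
    and w: "w * s (Suc 0) = s (Suc 0) * w" "w * z = z * w"
  shows "w * s n = s n * w"
proof (induction n rule: induct_nat_012)
  case (ge2 n)
  have "w * s (Suc (Suc n)) = (w * s (Suc n)) * s (Suc 0) - (w * z) * s n"
    by (simp only: s right_diff_distrib mult.assoc)
  also have "\<dots> = s (Suc n) * (w * s (Suc 0)) - z * (w * s n)"
    by (simp only: ge2.IH(2) w(2) mult.assoc)
  also have "\<dots> = s (Suc (Suc n)) * w"
    by (simp only: ge2.IH(1) w(1) s left_diff_distrib mult.assoc)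
  finally show ?case .
qed (simp_all add: s w)

text \<open>Since \<open>s\<^sub>n\<^sub>+\<^sub>2 P\<^sub>k\<^sub>+\<^sub>1 = s\<^sub>n\<^sub>+\<^sub>1 (P\<^sub>k\<^sub>+\<^sub>2 + z P\<^sub>k) - z s\<^sub>n P\<^sub>k\<^sub>+\<^sub>1\<close>, the induction hypothesis for
  \<open>k + 1\<close> cancels the last term.\<close>

lemma chebyshev_left:
  fixes s P :: "nat \<Rightarrow> 'r::ring_1"
  assumes s: "s 0 = 1" "\<And>n. s (Suc (Suc n)) = s (Suc n) * s (Suc 0) - z * s n"
    and comm: "z * s (Suc 0) = s (Suc 0) * z"
    and P: "\<And>k. s (Suc 0) * P (Suc k) = P (Suc (Suc k)) + z * P k"
  shows "s (Suc n) * P (Suc k) = P (Suc (Suc (k + n))) + z * s n * P k"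
proof -
  have sz: "s n * z = z * s n" for n
    by (rule chebyshev_commute[OF s comm refl, symmetric])
  show ?thesis
  proof (induction n arbitrary: k)
    case 0
    then show ?case by (simp add: s P)
  next
    case (Suc n)
    have "s (Suc (Suc n)) * P (Suc k) = s (Suc n) * (s (Suc 0) * P (Suc k)) - z * s n * P (Suc k)"
      by (simp only: s left_diff_distrib mult.assoc)
    also have "\<dots> = s (Suc n) * P (Suc (Suc k)) + s (Suc n) * z * P k - z * s n * P (Suc k)"
      by (simp only: P distrib_left mult.assoc)
    also have "\<dots> = P (Suc (Suc (k + Suc n))) + z * s (Suc n) * P k"
      by (simp add: Suc.IH[of "Suc k"] sz)
    finally show ?case .
  qed
qed

lemma chebyshev_right:
  fixes s Y :: "nat \<Rightarrow> 'r::ring_1"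
  assumes s: "s 0 = 1" "\<And>n. s (Suc (Suc n)) = s (Suc n) * s (Suc 0) - z * s n"
    and comm: "z * s (Suc 0) = s (Suc 0) * z"
    and Y: "\<And>k. Y (Suc k) * s (Suc 0) = Y (Suc (Suc k)) + Y k * z"
  shows "Y (Suc k) * s (Suc n) = Y (Suc (Suc (k + n))) + Y k * z * s n"
proof -
  have ss: "s n * s (Suc 0) = s (Suc 0) * s n" for n
    by (rule chebyshev_commute[OF s refl comm[symmetric], symmetric])
  show ?thesis
  proof (induction n arbitrary: k)
    case 0
    then show ?case by (simp add: s Y)
  next
    case (Suc n)
    have "Y (Suc k) * s (Suc (Suc n)) = (Y (Suc k) * s (Suc 0)) * s (Suc n) - Y (Suc k) * z * s n"
      by (simp only: s(2) ss right_diff_distrib mult.assoc)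
    also have "\<dots> = Y (Suc (Suc k)) * s (Suc n) + Y k * z * s (Suc n) - Y (Suc k) * z * s n"
      by (simp only: Y distrib_right mult.assoc)
    also have "\<dots> = Y (Suc (Suc (k + Suc n))) + Y k * z * s (Suc n)"
      by (simp add: Suc.IH[of "Suc k"])
    finally show ?case .
  qed
qed


section \<open>Multiplication of cluster variables\<close>

lemma preprojective_coeff_0:
  "preprojective_coeff 0 b = (if b = (1, 0, -1, 0) then 1 else (0 :: ('k::{field,finite}) coeff))"
proof -
  obtain b1 b2 b3 b4 where b: "b = (b1, b2, b3, b4)" by (metis surj_pair)
  show ?thesis
  proof (cases "b3 = -1 \<and> b4 = 0")
    case True
    then have 34: "b3 = -1" "b4 = 0" by simp_all
    show ?thesis unfolding b 34 by (simp add: preprojective_coeff_def count_subs_0)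
  next
    case False
    then have "count_subs 0 (int 0 - 1 - b3) (int 0 - b4) = (0 :: 'k coeff)"
      unfolding count_subs_0 by auto
    then show ?thesis using False
      unfolding b preprojective_coeff_def prod.case by (simp only: mult_zero_left if_cancel prod.inject) auto
  qed
qed
lemma preinjective_coeff_0:
  "preinjective_coeff 0 b = (if b = (0, 1, 0, 0) then 1 else (0 :: ('k::{field,finite}) coeff))"
proof -
  obtain b1 b2 b3 b4 where b: "b = (b1, b2, b3, b4)" by (metis surj_pair)
  show ?thesis
  proof (cases "b3 = 0 \<and> b4 = 0")
    case True
    then have 34: "b3 = 0" "b4 = 0" by simp_all
    show ?thesis unfolding b 34 by (simp add: preinjective_coeff_def count_subs_0)
  next
    case False
    then have "count_subs 0 b4 b3 = (0 :: 'k coeff)"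
      unfolding count_subs_0 by auto
    then show ?thesis using False
      unfolding b preinjective_coeff_def prod.case by (simp only: mult_zero_left if_cancel prod.inject) auto
  qed
qed
context
  fixes scale :: "'k::{field,finite} \<Rightarrow> 'v::ab_group_add \<Rightarrow> 'v"
    and V :: "int \<Rightarrow> 'v kronecker"
    and x :: "int \<Rightarrow> 'k qtorus"
  assumes vs: "vector_space scale"
    and fam: "kronecker_family scale V"
    and x: "x = cluster_var scale V"
begin

lemma tcoeff_preprojective: "tcoeff (x (- int l)) b = preprojective_coeff (Suc l) b"
proof -
  obtain b1 b2 b3 b4 where b: "b = (b1, b2, b3, b4)" by (metis surj_pair)
  have V: "indecomposable scale (V (- int l))" "dim_vector scale (V (- int l)) = (l, l + 1)"
    using fam by (auto simp: kronecker_family_def)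
  have "tcoeff (cluster_char scale (V (- int l))) (b1, b2, b3, b4) =
    (if b1 = 2 * b4 - int l \<and> b2 = 2 * int l - 2 * b3 - int (l + 1)
     then count_subs (Suc l) (int l - b3) (int (l + 1) - b4) *
       qhalf (- euler_form (int l - b3, int (l + 1) - b4) (b3, b4)) else 0)"
    by (rule tcoeff_cluster_char[OF V(2)])
       (auto intro!: card_Gr_preprojective[OF vs V] count_subs_outside)
  moreover have "x (- int l) = cluster_char scale (V (- int l))"
    by (simp add: x cluster_var_def)
  ultimately show ?thesis
    by (auto simp: b preprojective_coeff_def simp del: euler_form.simps)
qed

lemma tcoeff_preinjective: "tcoeff (x (int l + 3)) b = preinjective_coeff (Suc l) b"
proof -
  obtain b1 b2 b3 b4 where b: "b = (b1, b2, b3, b4)" by (metis surj_pair)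
  have V: "indecomposable scale (V (int l + 3))" "dim_vector scale (V (int l + 3)) = (l + 1, l)"
    using fam by (auto simp: kronecker_family_def)
  have "tcoeff (cluster_char scale (V (int l + 3))) (b1, b2, b3, b4) =
    (if b1 = 2 * b4 - int (l + 1) \<and> b2 = 2 * int (l + 1) - 2 * b3 - int l
     then count_subs (Suc l) (int l - (int l - b4)) (int l + 1 - (int (l + 1) - b3)) *
       qhalf (- euler_form (int (l + 1) - b3, int l - b4) (b3, b4)) else 0)"
    by (rule tcoeff_cluster_char[OF V(2), where N = "\<lambda>e1 e2. count_subs (Suc l) (int l - e2) (int l + 1 - e1)"])
       (auto intro!: card_Gr_preinjective[OF vs V] count_subs_outside)
  moreover have "x (int l + 3) = cluster_char scale (V (int l + 3))"
    by (simp add: x cluster_var_def)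
  moreover have "euler_form (int (l + 1) - b3, int l - b4) (b3, b4) = euler_form (b4, b3) (int l - b4, int (l + 1) - b3)"
    by (simp add: algebra_simps)
  ultimately show ?thesis
    by (auto simp: b preinjective_coeff_def simp del: euler_form.simps)
qed

lemma coefficient_commutes_X_delta: "X (0, 0, 1, 1) * X_delta = X_delta * (X (0, 0, 1, 1) :: 'k qtorus)"
  by (simp add: X_delta_def distrib_left distrib_right X_mult)

lemma x0_eq: "x 0 = X (2, -1, 0, 1) + X (0, -1, 0, 0)"
proof (rule tcoeff_eqI)
  fix b :: expo
  obtain b1 b2 b3 b4 where b: "b = (b1, b2, b3, b4)" by (metis surj_pair)
  show "tcoeff (x 0) b = tcoeff (X (2, -1, 0, 1) + X (0, -1, 0, 0)) b"
    using tcoeff_preprojective[of 0 b] by (auto simp: b preprojective_coeff_def count_subs_1 tcoeff_X)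
qed

lemma x3_eq: "x 3 = X (-1, 0, 1, 0) + X (-1, 2, 0, 0)"
proof (rule tcoeff_eqI)
  fix b :: expo
  obtain b1 b2 b3 b4 where b: "b = (b1, b2, b3, b4)" by (metis surj_pair)
  show "tcoeff (x 3) b = tcoeff (X (-1, 0, 1, 0) + X (-1, 2, 0, 0)) b"
    using tcoeff_preinjective[of 0 b] by (auto simp: b preinjective_coeff_def count_subs_1 tcoeff_X)
qed

text \<open>The sequence \<open>x\<^sub>0, x\<^sub>-\<^sub>1, x\<^sub>-\<^sub>2, \<dots>\<close> is preceded by \<open>X (1, 0, -1, 0)\<close>.  The identity for \<open>x 0\<close> is
  then the general one, as \<open>X (0, 0, 1, 1) * X (1, 0, -1, 0)\<close> is a power of \<open>q\<^sup>1\<^sup>/\<^sup>2\<close> times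
  \<open>X (1, 0, 0, 1)\<close>.\<close>

lemma preprojective_multiplication:
  "S (Suc n) * x 0 = x (- int (Suc n)) + qhalf (-1) \<cdot> (S n * X (1, 0, 0, 1))"
  "S (Suc n) * x (- int (Suc m)) = x (- (int (Suc m) + int (Suc n))) + X (0, 0, 1, 1) * S n * x (- int m)"
proof -
  define P where "P j = (if j = 0 then X (1, 0, -1, 0) else x (1 - int j))" for j
  have "tcoeff (P j) b = preprojective_coeff j b" for j b
  proof (cases j)
    case 0
    then show ?thesis by (auto simp: P_def preprojective_coeff_0 tcoeff_X)
  next
    case (Suc l)
    then show ?thesis using tcoeff_preprojective[of l b] by (simp add: P_def)
  qed
  then have rec: "S (Suc 0) * P (Suc k) = P (Suc (Suc k)) + X (0, 0, 1, 1) * P k" for k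
    by (simp add: preprojective_recurrence)
  have key: "S (Suc n) * P (Suc k) = P (Suc (Suc (k + n))) + X (0, 0, 1, 1) * S n * P k" for n k
    by (rule chebyshev_left) (simp_all add: rec[simplified] coefficient_commutes_X_delta)
  have zS: "X (0, 0, 1, 1) * S n = S n * (X (0, 0, 1, 1) :: 'k qtorus)"
    by (rule chebyshev_commute) (simp_all add: coefficient_commutes_X_delta)
  have "X (0, 0, 1, 1) * S n * P 0 = S n * (X (0, 0, 1, 1) * P 0)"
    by (simp add: zS mult.assoc)
  also have "\<dots> = qhalf (-1) \<cdot> (S n * X (1, 0, 0, 1))"
    by (simp add: P_def X_mult scl_mult_right)
  finally show "S (Suc n) * x 0 = x (- int (Suc n)) + qhalf (-1) \<cdot> (S n * X (1, 0, 0, 1))"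
    using key[of n 0] by (simp add: P_def)
  show "S (Suc n) * x (- int (Suc m)) = x (- (int (Suc m) + int (Suc n))) + X (0, 0, 1, 1) * S n * x (- int m)"
    using key[of n "Suc m"] by (simp add: P_def algebra_simps)
qed

text \<open>The recurrence for the sequence \<open>x\<^sub>2, x\<^sub>3, x\<^sub>4, \<dots>\<close> comes from the submodule count.  It extends to
  two more terms on the left: the one for \<open>x\<^sub>2\<close> is checked from \<open>x\<^sub>1\<close> and the explicit \<open>x\<^sub>3\<close>, and the
  one for \<open>x\<^sub>1\<close> holds with a term before \<open>x\<^sub>1\<close> chosen to produce \<open>x\<^sub>0 y\<^sub>1\<close>.\<close>

lemma preinjective_multiplication:
  "x 1 * S (Suc n) = x (int (Suc n) + 1) + qhalf (-1) \<cdot> (x 0 * y1 * S n)"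
  "x (int m + 2) * S (Suc n) = x (int (Suc n) + (int m + 2)) + x (int m + 1) * X (0, 0, 1, 1) * S n"
proof -
  define R where "R j = x (int j + 2)" for j
  have "tcoeff (R j) b = preinjective_coeff j b" for j b
  proof (cases j)
    case 0
    then show ?thesis by (auto simp: R_def x cluster_var_def preinjective_coeff_0 tcoeff_X)
  next
    case (Suc l)
    then show ?thesis using tcoeff_preinjective[of l b] by (simp add: R_def add.commute)
  qed
  then have R: "R (Suc j) * X_delta = R (Suc (Suc j)) + R j * X (0, 0, 1, 1)" for j
    by (rule preinjective_recurrence)
  \<comment> \<open>The value at \<open>0\<close> solves \<open>Y 0 * X (0, 0, 1, 1) = q\<^sup>-\<^sup>1\<^sup>/\<^sup>2 x\<^sub>0 y\<^sub>1\<close>.\<close>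
  define Y where "Y k = (if k = 0 then qhalf (-1) \<cdot> (x 0 * y1 * X (0, 0, -1, -1)) else x (int k))" for k
  have Y0: "Y 0 * X (0, 0, 1, 1) = qhalf (-1) \<cdot> (x 0 * y1)"
  proof -
    have "X (0, 0, -1, -1) * X (0, 0, 1, 1) = (1 :: 'k qtorus)"
      by (simp add: X_mult one_scl X_zero[symmetric] zero_prod_def)
    then show ?thesis by (simp add: Y_def scl_mult_left mult.assoc)
  qed
  have x12: "x 1 = X (1, 0, 0, 0)" "x 2 = X (0, 1, 0, 0)" by (simp_all add: x cluster_var_def)
  have rec: "Y (Suc k) * S (Suc 0) = Y (Suc (Suc k)) + Y k * X (0, 0, 1, 1)" for k
  proof -
    consider "k = 0" | "k = 1" | j where "k = Suc (Suc j)" by (cases k rule: nat.exhaust, simp) (metis not0_implies_Suc One_nat_def)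
    then show ?thesis
    proof cases
      case 1
      have "x 1 * X_delta = x 2 + qhalf (-1) \<cdot> (x 0 * y1)"
        by (rule tcoeff_eqI)
           (simp add: x12 x0_eq y1_def X_delta_def X_mult distrib_left distrib_right)
      then show ?thesis using 1 Y0 by (simp add: Y_def)
    next
      case 2
      have "x 2 * X_delta = x 3 + x 1 * X (0, 0, 1, 1)"
        by (simp add: x12 x3_eq X_delta_def X_mult distrib_left one_scl)
      then show ?thesis using 2 by (simp add: Y_def)
    next
      case 3
      then show ?thesis using R[of j] by (simp add: Y_def R_def algebra_simps)
    qed
  qed
  have key: "Y (Suc k) * S (Suc n) = Y (Suc (Suc (k + n))) + Y k * X (0, 0, 1, 1) * S n" for n k
    by (rule chebyshev_right) (simp_all add: rec[simplified] coefficient_commutes_X_delta)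
  show "x 1 * S (Suc n) = x (int (Suc n) + 1) + qhalf (-1) \<cdot> (x 0 * y1 * S n)"
    using key[of 0 n] unfolding Y0 by (simp add: Y_def scl_mult_left algebra_simps)
  show "x (int m + 2) * S (Suc n) = x (int (Suc n) + (int m + 2)) + x (int m + 1) * X (0, 0, 1, 1) * S n"
    using key[of "Suc m" n] by (simp add: Y_def algebra_simps)
qed

end

theorem theorem3p6:
  fixes scale :: "'k::{field,finite} \<Rightarrow> 'v::ab_group_add \<Rightarrow> 'v"
    and V :: "int \<Rightarrow> 'v kronecker"
    and x :: "int \<Rightarrow> 'k qtorus"
  assumes "vector_space scale"
    and "kronecker_family scale V"
    and x: "x = cluster_var scale V"
  shows "(\<forall>n::nat. n \<ge> 1 \<longrightarrow>
      S n * x 0 = x (- int n) + qhalf (-1) \<cdot> (S (n - 1) * X (1, 0, 0, 1))) \<and>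
    (\<forall>n m::nat. n \<ge> 1 \<longrightarrow> m \<ge> 1 \<longrightarrow>
      S n * x (- int m) = x (- (int m + int n)) + X (0, 0, 1, 1) * S (n - 1) * x (- (int m - 1))) \<and>
    (\<forall>n::nat. n \<ge> 1 \<longrightarrow>
      x 1 * S n = x (int n + 1) + qhalf (-1) \<cdot> (x 0 * y1 * S (n - 1))) \<and>
    (\<forall>n m::nat. n \<ge> 1 \<longrightarrow> m \<ge> 2 \<longrightarrow>
      x (int m) * S n = x (int n + int m) + x (int m - 1) * X (0, 0, 1, 1) * S (n - 1))"
proof (intro conjI allI impI)
  note left = preprojective_multiplication[OF assms] and right = preinjective_multiplication[OF assms]
  fix n :: nat
  assume "n \<ge> 1"
  then obtain n' where n: "n = Suc n'" by (cases n) auto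
  show "S n * x 0 = x (- int n) + qhalf (-1) \<cdot> (S (n - 1) * X (1, 0, 0, 1))"
    using left(1)[of n'] by (simp only: n diff_Suc_1)
  show "x 1 * S n = x (int n + 1) + qhalf (-1) \<cdot> (x 0 * y1 * S (n - 1))"
    using right(1)[of n'] by (simp only: n diff_Suc_1)
next
  note left = preprojective_multiplication[OF assms]
  fix n m :: nat
  assume "n \<ge> 1" "m \<ge> 1"
  then obtain n' m' where n: "n = Suc n'" and m: "m = Suc m'" by (metis Suc_pred' less_eq_Suc_le One_nat_def)
  have "int m - 1 = int m'" by (simp add: m)
  then show "S n * x (- int m) = x (- (int m + int n)) + X (0, 0, 1, 1) * S (n - 1) * x (- (int m - 1))"
    using left(2)[of n' m'] by (simp only: n m diff_Suc_1)
next
  note right = preinjective_multiplication[OF assms]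
  fix n m :: nat
  assume "n \<ge> 1" "m \<ge> 2"
  then obtain n' m' where n: "n = Suc n'" and m: "m = m' + 2"
    by (metis Suc_pred' less_eq_Suc_le One_nat_def le_add_diff_inverse2)
  have "int m - 1 = int m' + 1" "int m = int m' + 2" by (simp_all add: m)
  then show "x (int m) * S n = x (int n + int m) + x (int m - 1) * X (0, 0, 1, 1) * S (n - 1)"
    using right(2)[of m' n'] by (simp only: n diff_Suc_1)
qed

end
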